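(* Let $\{Q_n\}_{n\in\mathbb{N}}$ be a sequence of quadrature formulas on $\mathbb{S}^2$, $Q_n(f)=\sum_{j=1}^{N_n}w_j^{(n)}f(\mathbf{x}_j^{(n)})$, and let $L_n:=L_{n,Q_n}$ denote the associated degree-$n$ hyperinterpolation operator. Then $$\lim_{n\to\infty}\|L_nf-f\|_{L^2(\mathbb{S}^2)}=0\qquad\text{for all } f\in C(\mathbb{S}^2)$$ if and only if the following two conditions both hold: (1) there exists a constant $C>0$, independent of $n$, such that for every $n\in\mathbb{N}$, $$\sum_{j=1}^{N_n}|w_j^{(n)}||p(\mathbf{x}_j^{(n)})|\leq C\|p\|_{L^2(\mathbb{S}^2)}\quad\text{for all } p\in\mathbb{P}_n(\mathbb{S}^2);$$ (2) $\lim_{n\to\infty}\|L_np-p\|_{L^2(\mathbb{S}^2)}=0$ for all $p\in\mathbb{P}(\mathbb{S}^2)$.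
   Context: $\mathbb{S}^2=\{\mathbf{x}\in\mathbb{R}^3:\|\mathbf{x}\|_2=1\}$ carries the surface measure $\omega$ with $\omega(\mathbb{S}^2)=4\pi$; $C(\mathbb{S}^2)$ is the space of real-valued continuous functions with the uniform norm $\|\cdot\|_\infty$; $L^2(\mathbb{S}^2)$ is taken with respect to $\omega$. $\mathbb{N}=\{1,2,\ldots\}$. $\mathbb{H}_\ell$ is the space of spherical harmonics of degree $\ell$ (restrictions to $\mathbb{S}^2$ of real harmonic homogeneous polynomials of degree $\ell$ on $\mathbb{R}^3$), $\{Y_{\ell,k}: |k|\le \ell\}$ is an $L^2(\mathbb{S}^2)$-orthonormal basis of $\mathbb{H}_\ell$, $\mathbb{P}_n(\mathbb{S}^2)=\bigoplus_{\ell=0}^n\mathbb{H}_\ell$ is the space of spherical polynomials of degree at most $n$, and $\mathbb{P}(\mathbb{S}^2)=\bigoplus_{\ell=0}^\infty\mathbb{H}_\ell$ is the space of all spherical polynomials. A quadrature formula is a linear functional $Q(f)=\sum_{j=1}^N w_jf(\mathbf{x}_j)$ on $C(\mathbb{S}^2)$ given by $N$ pairwise distinct nodes $\mathbf{x}_1,\ldots,\mathbf{x}_N\in\mathbb{S}^2$ and arbitrary real (possibly signed) weights $w_1,\ldots,w_N$. In a sequence $\{Q_n\}$, the nodes, weights and number of nodes $N_n$ may all depend on $n$, and $n$ is only an index, not a degree of exactness. The degree-$n$ hyperinterpolation operator associated with $Q$ is $L_{n,Q}:C(\mathbb{S}^2)\to\mathbb{P}_n(\mathbb{S}^2)$, $L_{n,Q}f:=\sum_{\ell=0}^n\sum_{k=-\ell}^{\ell}Q(fY_{\ell,k})\,Y_{\ell,k}$.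 *)

theory Defs
  imports "HOL-Analysis.Analysis"
begin

abbreviation S2 :: "(real^3) set" where
  "S2 \<equiv> sphere 0 1"

(* Cone construction: omega A is three times the volume of the cone
   {r x. 0 < r \<le> 1, x \<in> A} over A (see emeasure_surface_measure), which is what polar
   coordinates dx = r^2 dr d\<omega> give. *)
definition surface_measure :: "(real^3) measure" where
  "surface_measure =
     scale_measure 3
       (distr (restrict_space lborel (cball 0 1 - {0})) (restrict_space borel S2)
         (\<lambda>x. x /\<^sub>R norm x))"

definition inner_L2 :: "(real^3 \<Rightarrow> real) \<Rightarrow> (real^3 \<Rightarrow> real) \<Rightarrow> real" where
  "inner_L2 f g = (\<integral>x. f x * g x \<partial>surface_measure)"

(* Only meaningful for square-integrable f; it is applied here to functions that are
   continuous on the sphere. *)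
definition norm_L2 :: "(real^3 \<Rightarrow> real) \<Rightarrow> real" where
  "norm_L2 f = sqrt (\<integral>x. (f x)\<^sup>2 \<partial>surface_measure)"

definition laplacian :: "('a::euclidean_space \<Rightarrow> real) \<Rightarrow> 'a \<Rightarrow> real" where
  "laplacian f x =
     (\<Sum>b\<in>Basis. frechet_derivative (\<lambda>y. frechet_derivative f (at y) b) (at x) b)"

definition homogeneous_polynomial :: "nat \<Rightarrow> (real^3 \<Rightarrow> real) \<Rightarrow> bool" where
  "homogeneous_polynomial l p \<longleftrightarrow>
     real_polynomial_function p \<and> (\<forall>t x. p (t *\<^sub>R x) = t ^ l * p x)"

(* A function on the sphere is represented by a function on R^3 of which only the values on
   S2 matter; the function spaces below are closed under changing values off S2. *)

definition spherical_harmonics :: "nat \<Rightarrow> (real^3 \<Rightarrow> real) set" where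
  "spherical_harmonics l =
     {f. \<exists>p. homogeneous_polynomial l p \<and> (\<forall>x. laplacian p x = 0) \<and> (\<forall>x\<in>S2. f x = p x)}"

definition spherical_polynomials_upto :: "nat \<Rightarrow> (real^3 \<Rightarrow> real) set" where
  "spherical_polynomials_upto n =
     {f. \<exists>h. (\<forall>l\<le>n. h l \<in> spherical_harmonics l) \<and> (\<forall>x\<in>S2. f x = (\<Sum>l\<le>n. h l x))}"

definition spherical_polynomials :: "(real^3 \<Rightarrow> real) set" where
  "spherical_polynomials = (\<Union>n. spherical_polynomials_upto n)"

definition orthonormal_harmonic_basis :: "nat \<Rightarrow> (int \<Rightarrow> real^3 \<Rightarrow> real) \<Rightarrow> bool" where
  "orthonormal_harmonic_basis l Y \<longleftrightarrow>
     (\<forall>k\<in>{- int l..int l}. Y k \<in> spherical_harmonics l) \<and>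
     (\<forall>k\<in>{- int l..int l}. \<forall>k'\<in>{- int l..int l}.
        inner_L2 (Y k) (Y k') = (if k = k' then 1 else 0)) \<and>
     (\<forall>h\<in>spherical_harmonics l. \<exists>c.
        \<forall>x\<in>S2. h x = (\<Sum>k = - int l..int l. c k * Y k x))"

definition quadrature_data :: "nat \<Rightarrow> (nat \<Rightarrow> real^3) \<Rightarrow> bool" where
  "quadrature_data N x \<longleftrightarrow> N \<ge> 1 \<and> (\<forall>j\<in>{1..N}. x j \<in> S2) \<and> inj_on x {1..N}"

definition quadrature ::
  "nat \<Rightarrow> (nat \<Rightarrow> real^3) \<Rightarrow> (nat \<Rightarrow> real) \<Rightarrow> (real^3 \<Rightarrow> real) \<Rightarrow> real" where
  "quadrature N x w f = (\<Sum>j = 1..N. w j * f (x j))"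

definition hyperinterpolation ::
  "(nat \<Rightarrow> int \<Rightarrow> real^3 \<Rightarrow> real) \<Rightarrow> nat \<Rightarrow> ((real^3 \<Rightarrow> real) \<Rightarrow> real) \<Rightarrow>
   (real^3 \<Rightarrow> real) \<Rightarrow> real^3 \<Rightarrow> real" where
  "hyperinterpolation Y n Q f x =
     (\<Sum>l\<le>n. \<Sum>k = - int l..int l. Q (\<lambda>y. f y * Y l k y) * Y l k x)"

lemma sphere_projection_measurable:
  "(\<lambda>x::real^3. x /\<^sub>R norm x) \<in>
     restrict_space lborel (cball 0 1 - {0}) \<rightarrow>\<^sub>M restrict_space borel S2"
proof (rule measurable_restrict_space2)
  show "(\<lambda>x::real^3. x /\<^sub>R norm x) \<in> restrict_space lborel (cball 0 1 - {0}) \<rightarrow>\<^sub>M borel"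
    by (intro measurable_restrict_space1) measurable
qed (auto simp: space_restrict_space)

lemma space_surface_measure [simp]: "space surface_measure = S2"
  by (simp add: surface_measure_def space_scale_measure space_restrict_space)

lemma sets_surface_measure [simp]: "sets surface_measure = sets (restrict_space borel S2)"
  by (simp add: surface_measure_def)

lemma emeasure_surface_measure:
  assumes "A \<in> sets borel" "A \<subseteq> S2"
  shows "emeasure surface_measure A =
     3 * emeasure lborel {x \<in> cball 0 1 - {0}. x /\<^sub>R norm x \<in> A}"
proof -
  have A: "A \<in> sets (restrict_space borel S2)"
    using assms by (auto simp: sets_restrict_space_iff)
  have eq: "(\<lambda>x. x /\<^sub>R norm x) -` A \<inter> space (restrict_space lborel (cball 0 1 - {0}))
      = {x \<in> cball 0 1 - {0}. x /\<^sub>R norm x \<in> A}"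
    by (auto simp: space_restrict_space)
  show ?thesis
    unfolding surface_measure_def
    by (simp only: emeasure_scale_measure emeasure_distr[OF sphere_projection_measurable A] eq)
       (subst emeasure_restrict_space, auto)
qed

lemma emeasure_surface_measure_S2: "emeasure surface_measure S2 = ennreal (4 * pi)"
proof -
  have "{x \<in> cball 0 1 - {0}. x /\<^sub>R norm x \<in> S2} = cball (0::real^3) 1 - {0}"
    by auto
  then have "emeasure surface_measure S2 = 3 * emeasure lborel (cball (0::real^3) 1 - {0})"
    by (simp add: emeasure_surface_measure)
  also have "emeasure lborel (cball (0::real^3) 1 - {0}) = emeasure lborel (cball (0::real^3) 1)"
    by (subst emeasure_Diff) auto
  also have "\<dots> = ennreal (unit_ball_vol 3)"
    by (subst emeasure_cball) auto
  also have "unit_ball_vol 3 = 4 / 3 * pi"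
    by (rule unit_ball_vol_3)
  also have "3 * ennreal (4 / 3 * pi) = ennreal (4 * pi)"
    by (simp flip: ennreal_numeral ennreal_mult')
  finally show ?thesis .
qed

end

theory Submission
  imports Defs
begin

text \<open>If \<open>L\<^sub>n f\<close> converges for every continuous \<open>f\<close>, then by the uniform boundedness principle
  \<open>\<parallel>L\<^sub>n f\<parallel> \<le> C\<close> whenever \<open>\<bar>f\<bar> \<le> 1\<close>; testing with an \<open>f\<close> that has the sign of \<open>w\<^sub>j p(x\<^sub>j)\<close> at the
  nodes and using \<open>\<langle>L\<^sub>n f, p\<rangle> = Q\<^sub>n(f p)\<close> gives condition (1). Conversely, (1) and
  \<open>\<parallel>L\<^sub>n g\<parallel>\<^sup>2 = Q\<^sub>n(g L\<^sub>n g)\<close> give \<open>\<parallel>L\<^sub>n g\<parallel> \<le> C sup \<bar>g\<bar>\<close>, and the density of spherical polynomials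
  carries the convergence (2) over to all continuous functions.

  Two classical facts enter. Harmonics of different degrees are orthogonal: rotation invariance of
  the surface measure yields \<open>(d + 2) \<integral> x\<^sub>b p = \<integral> \<partial>\<^sub>b p\<close> for \<open>p\<close> homogeneous of degree \<open>d\<close>, hence
  Green's formula. Polynomials restrict to sums of harmonics: solving \<open>\<Delta>(\<bar>x\<bar>\<^sup>2 u) = \<Delta>p\<close> for a
  homogeneous \<open>u\<close> splits \<open>p\<close> as a harmonic polynomial plus \<open>\<bar>x\<bar>\<^sup>2 u\<close>.\<close>

section \<open>Directional derivatives of homogeneous polynomials\<close>

text \<open>The inner operation of \<open>laplacian\<close>, with the direction as first argument so
  that \<open>deriv_along v f\<close> is again a function to which the same rules apply.\<close>

definition deriv_along :: "'a::real_normed_vector \<Rightarrow> ('a \<Rightarrow> real) \<Rightarrow> 'a \<Rightarrow> real" where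
  "deriv_along v f x = frechet_derivative f (at x) v"

lemma laplacian_eq_deriv_along: "laplacian f x = (\<Sum>b\<in>Basis. deriv_along b (deriv_along b f) x)"
  by (simp add: laplacian_def deriv_along_def[abs_def])

lemma real_polynomial_function_has_derivative:
  fixes f :: "'a::euclidean_space \<Rightarrow> real"
  assumes "real_polynomial_function f"
  shows "(f has_derivative (\<lambda>v. deriv_along v f x)) (at x)"
  using differentiable_at_polynomial_function[of f x UNIV] assms
  by (simp add: real_polynomial_function_eq deriv_along_def frechet_derivative_works)

lemma deriv_along_eqI: "(f has_derivative f') (at x) \<Longrightarrow> deriv_along v f x = f' v"
  by (simp add: deriv_along_def frechet_derivative_at[symmetric])

lemma deriv_along_const [simp]: "deriv_along v (\<lambda>x. c) = (\<lambda>x. 0)"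
  by (rule ext, rule deriv_along_eqI) (rule has_derivative_const)

lemma deriv_along_linear: "bounded_linear f \<Longrightarrow> deriv_along v f = (\<lambda>x. f v)"
  by (rule ext, rule deriv_along_eqI) (rule bounded_linear_imp_has_derivative)

context
  fixes f g :: "'a::euclidean_space \<Rightarrow> real"
  assumes f: "real_polynomial_function f" and g: "real_polynomial_function g"
begin

text \<open>An equation between functions, not at a point, so that it rewrites inside a second
  \<open>deriv_along\<close> when a Laplacian is computed. The same holds for the difference and
  product rules.\<close>

lemma deriv_along_add:
  "deriv_along v (\<lambda>x. f x + g x) = (\<lambda>x. deriv_along v f x + deriv_along v g x)"
  by (rule ext, rule deriv_along_eqI[where f' = "\<lambda>v. deriv_along v f x + deriv_along v g x" for x])
     (intro has_derivative_add real_polynomial_function_has_derivative f g)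

lemma deriv_along_diff:
  "deriv_along v (\<lambda>x. f x - g x) = (\<lambda>x. deriv_along v f x - deriv_along v g x)"
  by (rule ext, rule deriv_along_eqI[where f' = "\<lambda>v. deriv_along v f x - deriv_along v g x" for x])
     (intro has_derivative_diff real_polynomial_function_has_derivative f g)

lemma deriv_along_mult:
  "deriv_along v (\<lambda>x. f x * g x) = (\<lambda>x. f x * deriv_along v g x + deriv_along v f x * g x)"
  by (rule ext, rule deriv_along_eqI
        [where f' = "\<lambda>v. f x * deriv_along v g x + deriv_along v f x * g x" for x])
     (intro has_derivative_mult real_polynomial_function_has_derivative f g)

end

lemma deriv_along_cmult:
  fixes f :: "'a::euclidean_space \<Rightarrow> real"
  assumes "real_polynomial_function f"
  shows "deriv_along v (\<lambda>x. c * f x) = (\<lambda>x. c * deriv_along v f x)"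
  using deriv_along_mult[OF real_polynomial_function.intros(2) assms, of v c] by simp

lemma real_polynomial_function_deriv_along [intro]:
  fixes f :: "'a::euclidean_space \<Rightarrow> real"
  assumes "real_polynomial_function f"
  shows "real_polynomial_function (deriv_along v f)"
  using assms
  by induction (auto simp: deriv_along_linear deriv_along_add deriv_along_mult)

lemma deriv_along_add_left:
  fixes f :: "'a::euclidean_space \<Rightarrow> real"
  assumes "real_polynomial_function f"
  shows "deriv_along (u + v) f x = deriv_along u f x + deriv_along v f x"
  using has_derivative_linear[OF real_polynomial_function_has_derivative[OF assms]]
  by (rule linear_add)

lemma deriv_along_scaleR_left:
  fixes f :: "'a::euclidean_space \<Rightarrow> real"
  assumes "real_polynomial_function f"
  shows "deriv_along (c *\<^sub>R v) f x = c * deriv_along v f x"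
  using linear_scale[OF has_derivative_linear[OF real_polynomial_function_has_derivative[OF assms]]]
  by simp

lemma deriv_along_sum_Basis:
  fixes f :: "'a::euclidean_space \<Rightarrow> real"
  assumes "real_polynomial_function f"
  shows "deriv_along v f x = (\<Sum>b\<in>Basis. (v \<bullet> b) * deriv_along b f x)"
proof -
  note lin = has_derivative_linear[OF real_polynomial_function_has_derivative[OF assms]]
  have "deriv_along v f x = deriv_along (\<Sum>b\<in>Basis. (v \<bullet> b) *\<^sub>R b) f x"
    by (simp add: euclidean_representation)
  also have "\<dots> = (\<Sum>b\<in>Basis. (v \<bullet> b) * deriv_along b f x)"
    by (simp add: linear_sum[OF lin] deriv_along_scaleR_left[OF assms])
  finally show ?thesis .
qed

lemma deriv_along_chain:
  fixes f :: "'a::euclidean_space \<Rightarrow> real"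
  assumes "real_polynomial_function f" "(g has_vector_derivative v) (at t)"
  shows "((\<lambda>t. f (g t)) has_real_derivative deriv_along v f (g t)) (at t)"
proof -
  have "((\<lambda>t. f (g t)) has_derivative (\<lambda>s. deriv_along (s *\<^sub>R v) f (g t))) (at t)"
    using diff_chain_at[OF assms(2)[unfolded has_vector_derivative_def]
        real_polynomial_function_has_derivative[OF assms(1)]]
    by (simp add: o_def)
  then show ?thesis
    by (simp add: deriv_along_scaleR_left[OF assms(1)] has_field_derivative_def mult_commute_abs)
qed

lemma real_polynomial_function_inner [intro]:
  "real_polynomial_function (\<lambda>x::'a::euclidean_space. x \<bullet> b)"
  by (intro real_polynomial_function.intros(1) bounded_linear_inner_left)

lemma deriv_along_inner: "deriv_along v (\<lambda>x::'a::euclidean_space. x \<bullet> b) = (\<lambda>x. v \<bullet> b)"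
  by (intro deriv_along_linear bounded_linear_inner_left)

section \<open>Homogeneous polynomials and Euler's identity\<close>

definition homog_poly :: "nat \<Rightarrow> ('a::euclidean_space \<Rightarrow> real) \<Rightarrow> bool" where
  "homog_poly l p \<longleftrightarrow> real_polynomial_function p \<and> (\<forall>t x. p (t *\<^sub>R x) = t ^ l * p x)"

text \<open>The algebra and the harmonic decomposition work in every dimension, so they are done for
  \<open>homog_poly\<close> over any Euclidean space; this carries them over to the notion used for
  spherical harmonics.\<close>

lemma homogeneous_polynomial_iff: "homogeneous_polynomial = homog_poly"
  by (intro ext) (simp add: homogeneous_polynomial_def homog_poly_def)

lemma homog_poly_add: "homog_poly l p \<Longrightarrow> homog_poly l q \<Longrightarrow> homog_poly l (\<lambda>x. p x + q x)"
  by (auto simp: homog_poly_def algebra_simps)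

lemma homog_poly_diff: "homog_poly l p \<Longrightarrow> homog_poly l q \<Longrightarrow> homog_poly l (\<lambda>x. p x - q x)"
  by (auto simp: homog_poly_def algebra_simps)

lemma homog_poly_cmult: "homog_poly l p \<Longrightarrow> homog_poly l (\<lambda>x. c * p x)"
  by (auto simp: homog_poly_def algebra_simps)

lemma homog_poly_mult: "homog_poly l p \<Longrightarrow> homog_poly m q \<Longrightarrow> homog_poly (l + m) (\<lambda>x. p x * q x)"
  by (auto simp: homog_poly_def algebra_simps power_add)

lemma homog_poly_zero: "homog_poly l (\<lambda>x. 0)"
  by (auto simp: homog_poly_def)

lemma homog_poly_sum:
  "finite A \<Longrightarrow> (\<And>a. a \<in> A \<Longrightarrow> homog_poly l (p a)) \<Longrightarrow> homog_poly l (\<lambda>x. \<Sum>a\<in>A. p a x)"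
  by (induction A rule: finite_induct) (auto intro: homog_poly_add homog_poly_zero)

lemma homog_poly_const: "homog_poly 0 (\<lambda>x. c)"
  by (auto simp: homog_poly_def)

lemma homog_poly_linear: "bounded_linear p \<Longrightarrow> homog_poly 1 p"
  by (auto simp: homog_poly_def linear_scale bounded_linear.linear)

lemma homog_poly_inner: "homog_poly 2 (\<lambda>x::'a::euclidean_space. x \<bullet> x)"
proof -
  have "homog_poly 2 (\<lambda>x::'a. \<Sum>b\<in>Basis. (x \<bullet> b) * (x \<bullet> b))"
    using homog_poly_mult[OF homog_poly_linear homog_poly_linear]
    by (intro homog_poly_sum) (auto simp: bounded_linear_inner_left numeral_2_eq_2)
  then show ?thesis
    by (simp flip: euclidean_inner)
qed

lemma homog_poly_imp_polynomial: "homog_poly l p \<Longrightarrow> real_polynomial_function p"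
  by (simp add: homog_poly_def)

text \<open>Homogeneity with the scalar 0 reads \<open>p 0 = 0 ^ 0 * p x\<close>, and
  \<open>0 ^ 0 = 1\<close>.\<close>

lemma homog_poly_0_imp_const: "homog_poly 0 p \<Longrightarrow> p = (\<lambda>x. p 0)"
  by (rule ext) (metis homog_poly_def scaleR_zero_left power_0 mult_1)

lemma homog_poly_0_deriv_along: "homog_poly 0 p \<Longrightarrow> deriv_along v p = (\<lambda>x. 0)"
  by (subst homog_poly_0_imp_const) simp_all

text \<open>Euler's identity: the chain rule and the power rule both give the derivative of
  \<open>\<lambda>t. p (t *\<^sub>R x)\<close> at 1.\<close>

lemma euler_homog_poly:
  assumes "homog_poly l p"
  shows "deriv_along x p x = real l * p x"
proof -
  have p: "real_polynomial_function p" and hom: "\<And>t x. p (t *\<^sub>R x) = t ^ l * p x"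
    using assms by (auto simp: homog_poly_def)
  have "((\<lambda>t. t *\<^sub>R x) has_vector_derivative x) (at 1)"
    by (auto intro!: derivative_eq_intros)
  from deriv_along_chain[OF p this]
  have "((\<lambda>t. t ^ l * p x) has_real_derivative deriv_along x p x) (at 1)"
    by (simp add: hom)
  moreover have "((\<lambda>t. t ^ l * p x) has_real_derivative real l * p x) (at 1)"
    by (auto intro!: derivative_eq_intros)
  ultimately show ?thesis
    by (rule DERIV_unique)
qed

text \<open>Differentiating \<open>p (t *\<^sub>R x) = t ^ l * p x\<close> with respect to
  \<open>x\<close> produces a factor \<open>t\<close> on the left. It cancels for
  \<open>t \<noteq> 0\<close>, and \<open>t = 0\<close> follows by continuity. For
  \<open>l = 0\<close> the truncated degree \<open>l - 1\<close> is harmless because the derivative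
  is zero.\<close>

lemma homog_poly_deriv_along:
  assumes "homog_poly l p"
  shows "homog_poly (l - 1) (deriv_along v p)"
proof (cases "l = 0")
  case True
  with assms show ?thesis
    by (simp add: homog_poly_0_deriv_along homog_poly_zero)
next
  case False
  have p: "real_polynomial_function p" and hom: "\<And>t x. p (t *\<^sub>R x) = t ^ l * p x"
    using assms by (auto simp: homog_poly_def)
  have eq: "t * deriv_along v p (t *\<^sub>R x) = t ^ l * deriv_along v p x" for t x
  proof -
    have 1: "((\<lambda>s. x + s *\<^sub>R v) has_vector_derivative v) (at 0)"
      by (auto intro!: derivative_eq_intros)
    have 2: "((\<lambda>s. t *\<^sub>R (x + s *\<^sub>R v)) has_vector_derivative t *\<^sub>R v) (at 0)"
      by (auto intro!: derivative_eq_intros)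
    have "((\<lambda>s. t ^ l * p (x + s *\<^sub>R v)) has_real_derivative t ^ l * deriv_along v p x) (at 0)"
      using DERIV_cmult[OF deriv_along_chain[OF p 1], of "t ^ l"] by simp
    moreover have "((\<lambda>s. t ^ l * p (x + s *\<^sub>R v)) has_real_derivative
        t * deriv_along v p (t *\<^sub>R x)) (at 0)"
      using deriv_along_chain[OF p 2] by (simp add: hom deriv_along_scaleR_left[OF p])
    ultimately show ?thesis
      using DERIV_unique by blast
  qed
  have nz: "deriv_along v p (t *\<^sub>R x) = t ^ (l - 1) * deriv_along v p x" if "t \<noteq> 0" for t x
    using eq[of t x] that False by (cases l) auto
  have "deriv_along v p (0 *\<^sub>R x) = 0 ^ (l - 1) * deriv_along v p x" for x
  proof (rule tendsto_unique)
    have "continuous_on UNIV (deriv_along v p)"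
      using p by (simp add: continuous_on_polymonial_function real_polynomial_function_deriv_along
          flip: real_polynomial_function_eq)
    then have "isCont (deriv_along v p) (0 *\<^sub>R x)"
      by (simp add: continuous_on_eq_continuous_at)
    then show "((\<lambda>t. deriv_along v p (t *\<^sub>R x)) \<longlongrightarrow> deriv_along v p (0 *\<^sub>R x)) (at 0)"
      by (rule isCont_tendsto_compose) (intro tendsto_intros)
    have "((\<lambda>t::real. t ^ (l - 1) * deriv_along v p x) \<longlongrightarrow> 0 ^ (l - 1) * deriv_along v p x) (at 0)"
      by (intro tendsto_intros)
    then show "((\<lambda>t. deriv_along v p (t *\<^sub>R x)) \<longlongrightarrow> 0 ^ (l - 1) * deriv_along v p x) (at 0)"
      by (rule Lim_transform_eventually) (auto simp: eventually_at_filter nz)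
  qed simp
  with nz p show ?thesis
    unfolding homog_poly_def by (metis real_polynomial_function_deriv_along)
qed

section \<open>The Laplacian of homogeneous polynomials\<close>

lemma homog_poly_laplacian:
  assumes "homog_poly l p"
  shows "homog_poly (l - 2) (laplacian p)"
proof -
  have "homog_poly (l - 2) (\<lambda>x. \<Sum>b\<in>Basis. deriv_along b (deriv_along b p) x)"
    using homog_poly_deriv_along[OF homog_poly_deriv_along[OF assms]]
    by (intro homog_poly_sum) (auto simp: numeral_2_eq_2)
  then show ?thesis
    by (simp add: laplacian_eq_deriv_along[abs_def])
qed

text \<open>In these degrees truncated subtraction lets \<open>homog_poly_laplacian\<close> say only
  that the Laplacian is constant. It vanishes because the first derivatives have degree
  \<open>l - 1 = 0\<close> and are themselves constant.\<close>

lemma laplacian_homog_poly_less_2: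
  assumes "homog_poly l p" "l < 2"
  shows "laplacian p = (\<lambda>x. 0)"
proof -
  have "deriv_along b (deriv_along b p) = (\<lambda>x. 0)" for b
    using homog_poly_deriv_along[OF assms(1)] assms(2) homog_poly_0_deriv_along[of "deriv_along b p"]
    by simp
  then show ?thesis
    by (intro ext) (simp add: laplacian_eq_deriv_along)
qed

lemma laplacian_add:
  assumes "real_polynomial_function f" "real_polynomial_function g"
  shows "laplacian (\<lambda>x. f x + g x) x = laplacian f x + laplacian g x"
  using assms
  by (simp add: laplacian_eq_deriv_along deriv_along_add real_polynomial_function_deriv_along
      sum.distrib)

lemma laplacian_diff:
  assumes "real_polynomial_function f" "real_polynomial_function g"
  shows "laplacian (\<lambda>x. f x - g x) x = laplacian f x - laplacian g x"
  using assms
  by (simp add: laplacian_eq_deriv_along deriv_along_diff real_polynomial_function_deriv_along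
      sum_subtractf)

lemma laplacian_cmult:
  assumes "real_polynomial_function f"
  shows "laplacian (\<lambda>x. c * f x) x = c * laplacian f x"
  using assms
  by (simp add: laplacian_eq_deriv_along deriv_along_cmult real_polynomial_function_deriv_along
      sum_distrib_left)

section \<open>Harmonic decomposition\<close>

text \<open>The product rule applied twice gives three terms per coordinate: the first sums to
  \<open>2 * DIM('a)\<close> times \<open>v\<close>, the mixed ones to \<open>4 * d\<close> times
  \<open>v\<close> by Euler's identity, the last to the Laplacian.\<close>

lemma laplacian_sq_norm_mult:
  fixes v :: "'a::euclidean_space \<Rightarrow> real"
  assumes "homog_poly d v"
  shows "laplacian (\<lambda>x. (x \<bullet> x) * v x) x
    = real (2 * DIM('a) + 4 * d) * v x + (x \<bullet> x) * laplacian v x"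
proof -
  have v: "real_polynomial_function v"
    using assms by (rule homog_poly_imp_polynomial)
  have i: "real_polynomial_function (\<lambda>x::'a. x \<bullet> x)"
    using homog_poly_inner by (rule homog_poly_imp_polynomial)
  have di: "deriv_along b (\<lambda>x. x \<bullet> x) = (\<lambda>x. 2 * (x \<bullet> b))" for b :: 'a
    by (rule ext, rule deriv_along_eqI[where f' = "\<lambda>b. 2 * (x \<bullet> b)" for x])
       (auto intro!: derivative_eq_intros simp: inner_commute)
  have "deriv_along b (deriv_along b (\<lambda>x. (x \<bullet> x) * v x)) x
      = 2 * v x + 4 * ((x \<bullet> b) * deriv_along b v x) + (x \<bullet> x) * deriv_along b (deriv_along b v) x"
    if "b \<in> Basis" for b
    using that v i
    by (simp add: deriv_along_mult di real_polynomial_function_deriv_along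
        deriv_along_add deriv_along_inner real_polynomial_function.intros(4) deriv_along_cmult
        real_polynomial_function.intros(2) real_polynomial_function_inner algebra_simps)
  then have "laplacian (\<lambda>x. (x \<bullet> x) * v x) x = (\<Sum>b\<in>Basis. 2 * v x
      + 4 * ((x \<bullet> b) * deriv_along b v x) + (x \<bullet> x) * deriv_along b (deriv_along b v) x)"
    by (simp add: laplacian_eq_deriv_along)
  also have "\<dots> = real (2 * DIM('a)) * v x + 4 * deriv_along x v x + (x \<bullet> x) * laplacian v x"
    by (simp add: sum.distrib deriv_along_sum_Basis[OF v, of x] laplacian_eq_deriv_along
        flip: sum_distrib_left)
  finally show ?thesis
    by (simp add: euler_homog_poly[OF assms] algebra_simps)
qed

text \<open>The coefficient \<open>a\<close> is kept arbitrary because the reduction to degree \<open>d - 2\<close> changes it.\<close>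
lemma homog_poly_solve:
  fixes q :: "'a::euclidean_space \<Rightarrow> real"
  assumes "homog_poly d q" "a > 0"
  shows "\<exists>u. homog_poly d u \<and> (\<forall>x. a * u x + (x \<bullet> x) * laplacian u x = q x)"
  using assms
proof (induction d arbitrary: a q rule: less_induct)
  case (less d)
  have q: "real_polynomial_function q"
    using less.prems by (auto intro: homog_poly_imp_polynomial)
  show ?case
  proof (cases "d < 2")
    case True
    have "homog_poly d (\<lambda>x. inverse a * q x)"
      by (rule homog_poly_cmult[OF less.prems(1)])
    moreover from this have "laplacian (\<lambda>x. inverse a * q x) = (\<lambda>x. 0)"
      using True by (rule laplacian_homog_poly_less_2)
    ultimately show ?thesis
      using less.prems(2) by (intro exI[of _ "\<lambda>x. inverse a * q x"]) auto
  next
    case False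
    \<comment> \<open>Inserting the ansatz u = q/a + |x|^2 v into the equation and dividing by |x|^2
      leaves an equation of the same kind for \<open>v\<close>: its coefficient is \<open>a'\<close>
      and its right-hand side is minus the Laplacian of \<open>q\<close> divided by
      \<open>a\<close>.\<close>
    define a' where "a' = a + real (2 * DIM('a) + 4 * (d - 2))"
    have "homog_poly (d - 2) (\<lambda>x. - inverse a * laplacian q x)"
      by (intro homog_poly_cmult homog_poly_laplacian less.prems)
    with less.IH[of "d - 2" _ a'] False less.prems(2) obtain v
      where v: "homog_poly (d - 2) v"
        and v_eq: "\<And>x. a' * v x + (x \<bullet> x) * laplacian v x = - inverse a * laplacian q x"
      unfolding a'_def by fastforce
    define u where "u = (\<lambda>x. inverse a * q x + (x \<bullet> x) * v x)"
    have rv: "homog_poly d (\<lambda>x. (x \<bullet> x) * v x)"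
      using homog_poly_mult[OF homog_poly_inner v] False by (simp del: One_nat_def add_2_eq_Suc)
    have "homog_poly d u"
      unfolding u_def by (intro homog_poly_add homog_poly_cmult less.prems rv)
    moreover have "a * u x + (x \<bullet> x) * laplacian u x = q x" for x
    proof -
      have "laplacian u x = inverse a * laplacian q x
          + (real (2 * DIM('a) + 4 * (d - 2)) * v x + (x \<bullet> x) * laplacian v x)"
        unfolding u_def
        by (subst laplacian_add)
           (simp_all add: real_polynomial_function.intros(4) real_polynomial_function.intros(2)
             laplacian_cmult laplacian_sq_norm_mult[OF v] q
             homog_poly_imp_polynomial[OF rv] del: of_nat_add)
      also have "\<dots> = inverse a * laplacian q x + (a' * v x + (x \<bullet> x) * laplacian v x) - a * v x"
        by (simp add: a'_def algebra_simps)
      also have "\<dots> = - a * v x"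
        by (simp add: v_eq)
      finally show ?thesis
        using less.prems(2) by (simp add: u_def algebra_simps)
    qed
    ultimately show ?thesis
      by blast
  qed
qed

text \<open>By \<open>laplacian_sq_norm_mult\<close>, harmonicity of p - |x|^2 u is exactly the
  equation of \<open>homog_poly_solve\<close> with the Laplacian of \<open>p\<close> on the right;
  its coefficient is positive because the dimension is.\<close>

lemma homog_poly_harmonic_decomposition:
  fixes p :: "'a::euclidean_space \<Rightarrow> real"
  assumes p: "homog_poly l p" and l: "l \<ge> 2"
  shows "\<exists>h u. homog_poly l h \<and> (\<forall>x. laplacian h x = 0) \<and> homog_poly (l - 2) u \<and>
    (\<forall>x. p x = h x + (x \<bullet> x) * u x)"
proof -
  have "real (2 * DIM('a) + 4 * (l - 2)) > 0"
    by (simp add: add_pos_nonneg)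
  then obtain u where u: "homog_poly (l - 2) u"
    and eq: "\<And>x. real (2 * DIM('a) + 4 * (l - 2)) * u x + (x \<bullet> x) * laplacian u x = laplacian p x"
    using homog_poly_solve[OF homog_poly_laplacian[OF p]] by blast
  have ru: "homog_poly l (\<lambda>x. (x \<bullet> x) * u x)"
    using homog_poly_mult[OF homog_poly_inner u] l by (simp del: One_nat_def add_2_eq_Suc)
  have "laplacian (\<lambda>x. p x - (x \<bullet> x) * u x) x = 0" for x
    using eq[of x]
    by (simp add: laplacian_diff laplacian_sq_norm_mult[OF u] homog_poly_imp_polynomial[OF p]
        homog_poly_imp_polynomial[OF ru])
  then show ?thesis
    using homog_poly_diff[OF p ru] u
    by (intro exI[of _ "\<lambda>x. p x - (x \<bullet> x) * u x"] exI[of _ u]) simp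
qed

section \<open>Integration over the sphere\<close>

lemma continuous_on_real_polynomial_function:
  "real_polynomial_function f \<Longrightarrow> continuous_on A f"
  by (simp add: continuous_on_polymonial_function real_polynomial_function_eq)

interpretation surface: finite_measure surface_measure
  by (rule finite_measureI) (simp add: emeasure_surface_measure_S2)

lemma measure_surface_S2: "measure surface_measure S2 = 4 * pi"
  by (simp add: measure_def emeasure_surface_measure_S2)

lemma continuous_on_imp_measurable_surface:
  "continuous_on S2 f \<Longrightarrow> f \<in> borel_measurable surface_measure"
  using borel_measurable_continuous_on_restrict
  by (simp cong: measurable_cong_sets)

lemma integrable_surface:
  fixes f :: "real^3 \<Rightarrow> real"
  assumes "continuous_on S2 f"
  shows "integrable surface_measure f"
proof -
  have "bounded (f ` S2)"
    using assms by (intro compact_imp_bounded compact_continuous_image) auto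
  then obtain B where "\<And>x. x \<in> S2 \<Longrightarrow> norm (f x) \<le> B"
    unfolding bounded_iff by blast
  with assms show ?thesis
    by (intro surface.integrable_const_bound[of _ B] continuous_on_imp_measurable_surface) auto
qed

lemma integrable_surface_polynomial:
  "real_polynomial_function f \<Longrightarrow> integrable surface_measure f"
  by (intro integrable_surface continuous_on_real_polynomial_function)

text \<open>\<open>T\<close> is linear and preserves norms, so it maps the cone over the preimage of
  \<open>A\<close> onto the cone over \<open>A\<close>; volume is invariant under
  \<open>T\<close>.\<close>

lemma emeasure_surface_orthogonal_image:
  fixes T :: "real^3 \<Rightarrow> real^3"
  assumes T: "orthogonal_transformation T" and A: "A \<in> sets borel" "A \<subseteq> S2"
  shows "emeasure surface_measure (T -` A) = emeasure surface_measure A"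
proof -
  note lin = orthogonal_transformation_linear[OF T]
  have norm: "norm (T x) = norm x" for x
    using T by (rule orthogonal_transformation_norm)
  have T_borel: "T \<in> borel_measurable borel"
    by (intro borel_measurable_continuous_onI linear_continuous_on linear_conv_bounded_linear[THEN iffD1] lin)
  have vim: "T -` A \<in> sets borel" "T -` A \<subseteq> S2"
    using measurable_sets[OF T_borel A(1)] A(2) norm by auto
  let ?cone = "\<lambda>A. {x \<in> cball (0::real^3) 1 - {0}. x /\<^sub>R norm x \<in> A}"
  have cone: "?cone A \<in> sets lborel" if "A \<in> sets borel" for A
  proof -
    have "(\<lambda>x::real^3. x /\<^sub>R norm x) \<in> borel_measurable borel"
      by measurable
    from measurable_sets[OF this that]
    have "(cball 0 1 - {0}) \<inter> (\<lambda>x. x /\<^sub>R norm x) -` A \<in> sets borel"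
      by auto
    moreover have "?cone A = (cball 0 1 - {0}) \<inter> (\<lambda>x. x /\<^sub>R norm x) -` A"
      by auto
    ultimately show ?thesis
      by simp
  qed
  have fin: "?cone A \<in> lmeasurable" if "A \<in> sets borel" for A
    using cone[OF that]
    by (intro bounded_set_imp_lmeasurable bounded_subset[OF bounded_cball[of 0 1]]) auto
  \<comment> \<open>\<open>measure_orthogonal_image\<close> speaks of
    \<open>measure lebesgue\<close> on sets of finite measure, while the surface measure is built
    from \<open>emeasure lborel\<close>; on these bounded Borel cones the two agree.\<close>
  have emeasure_cone: "emeasure lborel (?cone A) = ennreal (measure lebesgue (?cone A))"
    if "A \<in> sets borel" for A
  proof -
    have "emeasure lborel (?cone A) = emeasure lebesgue (?cone A)"
      using cone[OF that] sets_completionI_sets[OF cone[OF that]]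
      by (simp only: emeasure_completion main_part)
    then show ?thesis
      using emeasure_eq_measure2[OF fin[OF that]] by (rule trans)
  qed
  have "T ` ?cone (T -` A) = ?cone A"
  proof (intro equalityI subsetI)
    fix y assume "y \<in> ?cone A"
    moreover obtain x where "y = T x"
      using orthogonal_transformation_surj[OF T] by (metis surjD)
    ultimately show "y \<in> T ` ?cone (T -` A)"
      using norm linear_0[OF lin] by (auto simp: linear_scale[OF lin] intro!: imageI)
  qed (use norm in \<open>auto simp: linear_scale[OF lin]\<close>, metis norm norm_eq_zero)
  then have "measure lebesgue (?cone (T -` A)) = measure lebesgue (?cone A)"
    using measure_orthogonal_image[OF T fin[OF vim(1)]] by simp
  then have "emeasure lborel (?cone (T -` A)) = emeasure lborel (?cone A)"
    by (simp only: emeasure_cone vim(1) A(1))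
  then show ?thesis
    by (simp only: emeasure_surface_measure A vim)
qed

lemma integral_surface_orthogonal:
  fixes T :: "real^3 \<Rightarrow> real^3" and f :: "real^3 \<Rightarrow> real"
  assumes T: "orthogonal_transformation T" and f: "continuous_on S2 f"
  shows "(\<integral>x. f (T x) \<partial>surface_measure) = (\<integral>x. f x \<partial>surface_measure)"
proof -
  have norm: "norm (T x) = norm x" for x
    using T by (rule orthogonal_transformation_norm)
  have T_borel: "T \<in> borel_measurable borel"
    using orthogonal_transformation_linear[OF T]
    by (intro borel_measurable_continuous_onI linear_continuous_on) (simp add: linear_conv_bounded_linear)
  have T_surf: "T \<in> surface_measure \<rightarrow>\<^sub>M surface_measure"
  proof -
    have "T \<in> restrict_space borel S2 \<rightarrow>\<^sub>M restrict_space borel S2"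
      using T_borel norm
      by (intro measurable_restrict_space2 measurable_restrict_space1) (auto simp: space_restrict_space)
    then show ?thesis
      by (simp cong: measurable_cong_sets)
  qed
  have "distr surface_measure surface_measure T = surface_measure"
  proof (rule measure_eqI)
    fix A assume "A \<in> sets (distr surface_measure surface_measure T)"
    then have A': "A \<in> sets surface_measure" and A: "A \<in> sets borel" "A \<subseteq> S2"
      by (auto simp: sets_restrict_space_iff)
    have "T -` A \<inter> S2 = T -` A"
      using A norm by auto
    then show "emeasure (distr surface_measure surface_measure T) A = emeasure surface_measure A"
      by (simp add: emeasure_distr[OF T_surf A'] emeasure_surface_orthogonal_image[OF T A])
  qed simp
  then show ?thesis
    using integral_distr[OF T_surf continuous_on_imp_measurable_surface[OF f]] by simp
qed

text \<open>For orthonormal \<open>b\<close> and \<open>c\<close>, the rotation by the angle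
  \<open>t\<close> in the plane they span, fixing the orthogonal complement. Writing it as
  \<open>x\<close> plus a correction within the plane avoids completing \<open>b\<close>,
  \<open>c\<close> to a basis.\<close>

definition plane_rotation :: "'a::real_inner \<Rightarrow> 'a \<Rightarrow> real \<Rightarrow> 'a \<Rightarrow> 'a" where
  "plane_rotation b c t x =
     x + ((cos t - 1) * (x \<bullet> b) - sin t * (x \<bullet> c)) *\<^sub>R b
       + (sin t * (x \<bullet> b) + (cos t - 1) * (x \<bullet> c)) *\<^sub>R c"

context
  fixes b c :: "'a::real_inner"
  assumes orthonormal: "b \<bullet> b = 1" "c \<bullet> c = 1" "b \<bullet> c = 0"
begin

lemma plane_rotation_inner:
  "plane_rotation b c t x \<bullet> b = cos t * (x \<bullet> b) - sin t * (x \<bullet> c)"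
  "plane_rotation b c t x \<bullet> c = sin t * (x \<bullet> b) + cos t * (x \<bullet> c)"
  using orthonormal
  by (simp_all add: plane_rotation_def inner_add_left inner_commute[of c b] algebra_simps)

lemma orthogonal_transformation_plane_rotation: "orthogonal_transformation (plane_rotation b c t)"
  unfolding orthogonal_transformation
proof (intro conjI allI)
  show "linear (plane_rotation b c t)"
    by (rule linearI) (simp_all add: plane_rotation_def inner_add_left algebra_simps)
  fix x
  let ?p = "x \<bullet> b" and ?q = "x \<bullet> c" and ?R = "plane_rotation b c t x"
  \<comment> \<open>Only one factor is expanded, so that the remaining products with
    \<open>b\<close> and \<open>c\<close> are given by \<open>plane_rotation_inner\<close>.\<close>
  have "?R \<bullet> ?R = ?R \<bullet> x + ((cos t - 1) * ?p - sin t * ?q) * (?R \<bullet> b)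
      + (sin t * ?p + (cos t - 1) * ?q) * (?R \<bullet> c)"
    by (subst (2) plane_rotation_def) (simp add: inner_add_right)
  also have "?R \<bullet> x = x \<bullet> x + ((cos t - 1) * ?p - sin t * ?q) * ?p + (sin t * ?p + (cos t - 1) * ?q) * ?q"
    by (simp add: plane_rotation_def inner_add_left inner_commute[of b x] inner_commute[of c x])
  finally have "?R \<bullet> ?R = x \<bullet> x"
    using sin_cos_squared_add[of t] unfolding plane_rotation_inner by algebra
  then show "norm ?R = norm x"
    by (simp add: norm_eq_sqrt_inner)
qed

text \<open>The rotations are the flow of the field (x . b) c - (x . c) b. The derivative is
  expressed through the rotated point, so that along an orbit it is this field evaluated
  there.\<close>

lemma plane_rotation_has_vector_derivative:
  "((\<lambda>t. plane_rotation b c t x) has_vector_derivative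
     (plane_rotation b c t x \<bullet> b) *\<^sub>R c + (- (plane_rotation b c t x \<bullet> c)) *\<^sub>R b) (at t)"
  unfolding plane_rotation_inner
  unfolding plane_rotation_def
  by (auto intro!: derivative_eq_intros simp: algebra_simps has_vector_derivative_def)

end

text \<open>Rotation invariance, differentiated at the identity.\<close>
lemma integral_rotation_generator:
  fixes f :: "real^3 \<Rightarrow> real"
  assumes f: "real_polynomial_function f"
    and orthonormal: "b \<bullet> b = 1" "c \<bullet> c = 1" "b \<bullet> c = 0"
  shows "(\<integral>x. (x \<bullet> b) * deriv_along c f x - (x \<bullet> c) * deriv_along b f x \<partial>surface_measure) = 0"
proof -
  define R where "R = plane_rotation b c"
  define L where "L = (\<lambda>x. (x \<bullet> b) * deriv_along c f x - (x \<bullet> c) * deriv_along b f x)"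
  note orth = orthogonal_transformation_plane_rotation[OF orthonormal, folded R_def]
  have norm: "norm (R t x) = norm x" for t x
    using orth by (rule orthogonal_transformation_norm)
  have R0: "R 0 x = x" for x
    by (simp add: R_def plane_rotation_def)
  have L: "real_polynomial_function L"
    unfolding L_def
    by (intro real_polynomial_function_diff real_polynomial_function.intros(4)
        real_polynomial_function_deriv_along f real_polynomial_function_inner)
  have deriv: "((\<lambda>t. f (R t x)) has_real_derivative L (R t x)) (at t)" for t x
    using deriv_along_chain[OF f plane_rotation_has_vector_derivative[OF orthonormal]]
    unfolding L_def R_def deriv_along_add_left[OF f] deriv_along_scaleR_left[OF f] by simp
  have "bounded (L ` S2)"
    by (intro compact_imp_bounded compact_continuous_image
        continuous_on_real_polynomial_function L) auto
  then obtain M where M: "\<forall>x\<in>S2. \<bar>L x\<bar> \<le> M"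
    by (auto simp: bounded_iff)
  \<comment> \<open>Difference quotients at 0 of \<open>\<lambda>t. f (R t x)\<close>: they tend to
    \<open>L x\<close>, while rotation invariance makes each of their integrals vanish.\<close>
  define s where "s = (\<lambda>n x. (f (R (inverse (real (Suc n))) x) - f x) / inverse (real (Suc n)))"
  have f_cont: "continuous_on S2 f"
    using f by (rule continuous_on_real_polynomial_function)
  have fR_cont: "continuous_on S2 (\<lambda>x. f (R t x))" for t
    using orthogonal_transformation_linear[OF orth, of t] norm
    by (intro continuous_on_compose2[OF f_cont] linear_continuous_on)
       (auto simp: linear_conv_bounded_linear)
  have "(\<lambda>n. \<integral>x. s n x \<partial>surface_measure) \<longlonglongrightarrow> (\<integral>x. L x \<partial>surface_measure)"
  proof (rule integral_dominated_convergence)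
    show "L \<in> borel_measurable surface_measure"
      by (intro continuous_on_imp_measurable_surface continuous_on_real_polynomial_function L)
    show "s n \<in> borel_measurable surface_measure" for n
      unfolding s_def
      by (intro continuous_on_imp_measurable_surface continuous_intros fR_cont f_cont) simp
    show "integrable surface_measure (\<lambda>x. M)"
      by simp
    show "AE x in surface_measure. (\<lambda>n. s n x) \<longlonglongrightarrow> L x"
    proof (rule AE_I2)
      fix x
      have "((\<lambda>h. (f (R (0 + h) x) - f (R 0 x)) / h) \<longlongrightarrow> L (R 0 x)) (at 0)"
        using deriv[of x 0] by (simp add: DERIV_def)
      moreover have "filterlim (\<lambda>n. inverse (real (Suc n))) (at 0) sequentially"
        by (simp only: filterlim_at LIMSEQ_inverse_real_of_nat) simp
      ultimately show "(\<lambda>n. s n x) \<longlonglongrightarrow> L x"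
        unfolding s_def using filterlim_compose by (fastforce simp: R0)
    qed
    show "AE x in surface_measure. norm (s n x) \<le> M" for n
    proof (rule AE_I2)
      fix x assume "x \<in> space surface_measure"
      then have x: "norm x = 1" by simp
      \<comment> \<open>By the mean value theorem the quotient is a value of \<open>L\<close> at a
        rotated point, which still lies on the sphere; this gives the dominating constant
        \<open>M\<close>.\<close>
      have "0 < inverse (real (Suc n))" by simp
      from MVT2[OF this, of "\<lambda>t. f (R t x)" "\<lambda>t. L (R t x)"] deriv
      obtain z where "f (R (inverse (real (Suc n))) x) - f (R 0 x)
          = (inverse (real (Suc n)) - 0) * L (R z x)"
        by blast
      then have "s n x = L (R z x)"
        by (simp add: s_def R0)
      with M show "norm (s n x) \<le> M"
        by (simp add: norm x)
    qed
  qed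
  moreover have "(\<integral>x. s n x \<partial>surface_measure) = 0" for n
  proof -
    have "(\<integral>x. f (R t x) - f x \<partial>surface_measure) = 0" for t
      by (subst Bochner_Integration.integral_diff)
         (auto intro!: integrable_surface fR_cont f_cont simp: integral_surface_orthogonal[OF orth f_cont])
    then show ?thesis
      by (simp add: s_def del: of_nat_Suc)
  qed
  ultimately show ?thesis
    by (simp add: L_def LIMSEQ_const_iff)
qed

text \<open>The divergence theorem, obtained by summing the rotation identities for the functions
  \<open>(x \<bullet> c) p\<close> over the coordinate directions \<open>c\<close>.\<close>
lemma integral_surface_inner_mult:
  fixes p :: "real^3 \<Rightarrow> real"
  assumes p: "homog_poly d p" and b: "b \<in> Basis"
  shows "(real d + 2) * (\<integral>x. (x \<bullet> b) * p x \<partial>surface_measure) = (\<integral>x. deriv_along b p x \<partial>surface_measure)"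
proof -
  have rp: "real_polynomial_function p"
    using p by (rule homog_poly_imp_polynomial)
  define F where "F = (\<lambda>c x. (x \<bullet> b) * deriv_along c (\<lambda>x. (x \<bullet> c) * p x) x
    - (x \<bullet> c) * deriv_along b (\<lambda>x. (x \<bullet> c) * p x) x)"
  have rF: "real_polynomial_function (F c)" for c
    unfolding F_def
    by (intro real_polynomial_function_diff real_polynomial_function.intros(4)
        real_polynomial_function_deriv_along rp real_polynomial_function_inner)
  have F: "F c x = (x \<bullet> b) * p x + (x \<bullet> b) * ((x \<bullet> c) * deriv_along c p x)
      - (x \<bullet> c) * (x \<bullet> c) * deriv_along b p x
      - (b \<bullet> c) * (x \<bullet> c) * p x"
    if "c \<in> Basis" for c x
    using that
    unfolding F_def deriv_along_mult[OF real_polynomial_function_inner rp] deriv_along_inner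
    by (simp add: algebra_simps)
  \<comment> \<open>For \<open>c = b\<close> there is no rotation, but the integrand cancels
    identically, so the sum may run over the whole basis.\<close>
  have int_F: "(\<integral>x. F c x \<partial>surface_measure) = 0" if "c \<in> Basis" for c
    unfolding F_def
  proof (cases "c = b")
    case False
    with b that show "(\<integral>x. (x \<bullet> b) * deriv_along c (\<lambda>x. (x \<bullet> c) * p x) x
        - (x \<bullet> c) * deriv_along b (\<lambda>x. (x \<bullet> c) * p x) x \<partial>surface_measure) = 0"
      by (intro integral_rotation_generator real_polynomial_function.intros(4) rp
          real_polynomial_function_inner) (auto simp: inner_Basis)
  qed simp
  have "(\<Sum>c\<in>Basis. F c x) = (real d + 2) * ((x \<bullet> b) * p x) - deriv_along b p x"
    if "x \<in> S2" for x
  proof -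
    have xx: "(\<Sum>c\<in>Basis. (x \<bullet> c) * (x \<bullet> c)) = 1"
      using that by (simp flip: euclidean_inner power2_norm_eq_inner)
    \<comment> \<open>The factor 3 is the dimension. Euler's identity adds \<open>d\<close>, and the
      term with \<open>b \<bullet> c\<close> takes away 1, which makes \<open>d + 2\<close>.\<close>
    have "(\<Sum>c\<in>Basis. F c x) = 3 * ((x \<bullet> b) * p x)
        + (x \<bullet> b) * (\<Sum>c\<in>Basis. (x \<bullet> c) * deriv_along c p x)
        - (\<Sum>c\<in>Basis. (x \<bullet> c) * (x \<bullet> c)) * deriv_along b p x
        - (\<Sum>c\<in>Basis. (b \<bullet> c) * (x \<bullet> c)) * p x"
      by (simp add: F sum.distrib sum_subtractf sum_distrib_left sum_distrib_right)
    also have "(\<Sum>c\<in>Basis. (x \<bullet> c) * deriv_along c p x) = real d * p x"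
      using euler_homog_poly[OF p, of x] unfolding deriv_along_sum_Basis[OF rp, of x x] .
    also have "(\<Sum>c\<in>Basis. (b \<bullet> c) * (x \<bullet> c)) = x \<bullet> b"
      unfolding euclidean_inner[of b x, symmetric] by (rule inner_commute)
    finally show ?thesis
      by (simp add: xx algebra_simps)
  qed
  then have "(\<integral>x. (real d + 2) * ((x \<bullet> b) * p x) - deriv_along b p x \<partial>surface_measure)
      = (\<integral>x. (\<Sum>c\<in>Basis. F c x) \<partial>surface_measure)"
    by (intro Bochner_Integration.integral_cong) auto
  also have "\<dots> = 0"
    using rF by (subst Bochner_Integration.integral_sum)
      (auto simp: int_F integrable_surface_polynomial)
  finally show ?thesis
    by (subst (asm) Bochner_Integration.integral_diff)
       (auto intro!: integrable_surface_polynomial real_polynomial_function.intros(3,4) rp)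
qed

text \<open>The divergence theorem is applied to \<open>q\<close> times the derivative of
  \<open>p\<close> along \<open>b\<close> and summed over \<open>b\<close>. On the left Euler's
  identity produces \<open>l * p\<close>; on the right the term with the Laplacian of
  \<open>p\<close> drops out.\<close>

lemma green_homog_poly:
  fixes p q :: "real^3 \<Rightarrow> real"
  assumes p: "homog_poly l p" and q: "homog_poly m q" and harm: "\<And>x. laplacian p x = 0"
  shows "(real l + real m + 1) * real l * inner_L2 p q =
    (\<integral>x. (\<Sum>b\<in>Basis. deriv_along b p x * deriv_along b q x) \<partial>surface_measure)"
proof (cases "l = 0")
  case True
  with p show ?thesis
    by (simp add: homog_poly_0_deriv_along)
next
  case False
  have rp: "real_polynomial_function p" and rq: "real_polynomial_function q"
    using p q by (auto intro: homog_poly_imp_polynomial)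
  note rd = real_polynomial_function_deriv_along
  have step: "(real l + real m + 1) * (\<integral>x. (x \<bullet> b) * (q x * deriv_along b p x) \<partial>surface_measure)
      = (\<integral>x. q x * deriv_along b (deriv_along b p) x + deriv_along b p x * deriv_along b q x \<partial>surface_measure)"
    if "b \<in> Basis" for b
  proof -
    have hom: "homog_poly (m + (l - 1)) (\<lambda>x. q x * deriv_along b p x)"
      by (intro homog_poly_mult homog_poly_deriv_along p q)
    \<comment> \<open>This is where \<open>l \<noteq> 0\<close> matters: with truncated subtraction
      the degree count fails for \<open>l = 0\<close>.\<close>
    have eq: "real (m + (l - 1)) + 2 = real l + real m + 1"
      using False by linarith
    show ?thesis
      using integral_surface_inner_mult[OF hom that] unfolding eq
      by (simp add: deriv_along_mult[OF rq rd[OF rp]] mult.commute)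
  qed
  have "(real l + real m + 1) * real l * inner_L2 p q =
      (real l + real m + 1) * (\<integral>x. q x * (\<Sum>b\<in>Basis. (x \<bullet> b) * deriv_along b p x) \<partial>surface_measure)"
    by (simp add: inner_L2_def euler_homog_poly[OF p] mult_ac flip: deriv_along_sum_Basis[OF rp])
  also have "\<dots> = (\<Sum>b\<in>Basis. (real l + real m + 1) *
      (\<integral>x. (x \<bullet> b) * (q x * deriv_along b p x) \<partial>surface_measure))"
    unfolding sum_distrib_left
    by (subst Bochner_Integration.integral_sum)
       (auto intro!: integrable_surface_polynomial real_polynomial_function.intros(3,4) rd rp rq
         simp: sum_distrib_left mult.left_commute)
  also have "\<dots> = (\<integral>x. (\<Sum>b\<in>Basis. q x * deriv_along b (deriv_along b p) x
      + deriv_along b p x * deriv_along b q x) \<partial>surface_measure)"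
    by (subst Bochner_Integration.integral_sum)
       (auto intro!: integrable_surface_polynomial real_polynomial_function.intros(3,4) rd rp rq
         simp: step)
  also have "\<dots> = (\<integral>x. q x * laplacian p x + (\<Sum>b\<in>Basis. deriv_along b p x * deriv_along b q x) \<partial>surface_measure)"
    by (simp add: laplacian_eq_deriv_along sum.distrib sum_distrib_left)
  finally show ?thesis
    by (simp add: harm)
qed

section \<open>Orthogonality of harmonics of different degrees\<close>

lemma inner_L2_commute: "inner_L2 f g = inner_L2 g f"
  by (simp add: inner_L2_def mult.commute)

lemma inner_L2_cong:
  "(\<And>x. x \<in> S2 \<Longrightarrow> f x = f' x) \<Longrightarrow> (\<And>x. x \<in> S2 \<Longrightarrow> g x = g' x) \<Longrightarrow> inner_L2 f g = inner_L2 f' g'"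
  unfolding inner_L2_def by (intro Bochner_Integration.integral_cong) auto

lemma norm_L2_cong: "(\<And>x. x \<in> S2 \<Longrightarrow> f x = g x) \<Longrightarrow> norm_L2 f = norm_L2 g"
  unfolding norm_L2_def by (intro arg_cong[of _ _ sqrt] Bochner_Integration.integral_cong) auto

text \<open>The right-hand side of Green's formula is symmetric in \<open>p\<close> and
  \<open>q\<close>, whereas the left-hand side carries the factor \<open>l\<close> or
  \<open>m\<close>; subtracting the two versions leaves a nonzero multiple of the inner
  product.\<close>

lemma spherical_harmonics_orthogonal:
  assumes f: "f \<in> spherical_harmonics l" and g: "g \<in> spherical_harmonics m" and "l \<noteq> m"
  shows "inner_L2 f g = 0"
proof -
  obtain p where p: "homog_poly l p" "\<And>x. laplacian p x = 0" and fp: "\<And>x. x \<in> S2 \<Longrightarrow> f x = p x"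
    using f by (auto simp: spherical_harmonics_def homogeneous_polynomial_iff)
  obtain q where q: "homog_poly m q" "\<And>x. laplacian q x = 0" and gq: "\<And>x. x \<in> S2 \<Longrightarrow> g x = q x"
    using g by (auto simp: spherical_harmonics_def homogeneous_polynomial_iff)
  have "(real l + real m + 1) * real l * inner_L2 p q = (real m + real l + 1) * real m * inner_L2 q p"
    by (simp add: green_homog_poly[OF p(1) q(1) p(2)] green_homog_poly[OF q(1) p(1) q(2)]
        mult.commute[of "deriv_along _ p _"])
  then have "(real l + real m + 1) * (real l - real m) * inner_L2 p q = 0"
    by (simp add: inner_L2_commute[of q p] algebra_simps)
  with \<open>l \<noteq> m\<close> have "inner_L2 p q = 0"
    by (auto simp: add_nonneg_eq_0_iff)
  then show ?thesis
    by (metis inner_L2_cong fp gq)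
qed

section \<open>Spherical polynomials\<close>

lemma spherical_harmonics_zero: "(\<lambda>x. 0) \<in> spherical_harmonics l"
  unfolding spherical_harmonics_def homogeneous_polynomial_iff
  by (intro CollectI exI[of _ "\<lambda>x. 0"]) (simp add: homog_poly_zero laplacian_eq_deriv_along)

lemma spherical_harmonics_add:
  assumes "f \<in> spherical_harmonics l" "g \<in> spherical_harmonics l"
  shows "(\<lambda>x. f x + g x) \<in> spherical_harmonics l"
proof -
  obtain p q where "homog_poly l p" "\<And>x. laplacian p x = 0" "\<And>x. x \<in> S2 \<Longrightarrow> f x = p x"
    and "homog_poly l q" "\<And>x. laplacian q x = 0" "\<And>x. x \<in> S2 \<Longrightarrow> g x = q x"
    using assms by (auto simp: spherical_harmonics_def homogeneous_polynomial_iff)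
  then show ?thesis
    unfolding spherical_harmonics_def homogeneous_polynomial_iff
    by (intro CollectI exI[of _ "\<lambda>x. p x + q x"])
       (simp add: homog_poly_add laplacian_add homog_poly_imp_polynomial del: mem_sphere_0)
qed

lemma spherical_harmonics_cmult:
  assumes "f \<in> spherical_harmonics l"
  shows "(\<lambda>x. c * f x) \<in> spherical_harmonics l"
proof -
  obtain p where "homog_poly l p" "\<And>x. laplacian p x = 0" "\<And>x. x \<in> S2 \<Longrightarrow> f x = p x"
    using assms by (auto simp: spherical_harmonics_def homogeneous_polynomial_iff)
  then show ?thesis
    unfolding spherical_harmonics_def homogeneous_polynomial_iff
    by (intro CollectI exI[of _ "\<lambda>x. c * p x"])
       (simp add: homog_poly_cmult laplacian_cmult homog_poly_imp_polynomial del: mem_sphere_0)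
qed

lemma spherical_harmonics_sum:
  "finite A \<Longrightarrow> (\<And>a. a \<in> A \<Longrightarrow> f a \<in> spherical_harmonics l)
    \<Longrightarrow> (\<lambda>x. \<Sum>a\<in>A. f a x) \<in> spherical_harmonics l"
  by (induction A rule: finite_induct) (auto intro: spherical_harmonics_add spherical_harmonics_zero)

lemma continuous_on_spherical_harmonics:
  assumes "f \<in> spherical_harmonics l"
  shows "continuous_on S2 f"
proof -
  obtain p where p: "homog_poly l p" "\<And>x. x \<in> S2 \<Longrightarrow> f x = p x"
    using assms by (auto simp: spherical_harmonics_def homogeneous_polynomial_iff)
  show ?thesis
    by (rule iffD2[OF continuous_on_cong[OF refl p(2)]])
       (auto intro: continuous_on_real_polynomial_function homog_poly_imp_polynomial p)
qed

lemma spherical_polynomials_upto_mono: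
  assumes "n \<le> m"
  shows "spherical_polynomials_upto n \<subseteq> spherical_polynomials_upto m"
proof
  fix f assume "f \<in> spherical_polynomials_upto n"
  then obtain h where h: "\<And>l. l \<le> n \<Longrightarrow> h l \<in> spherical_harmonics l"
    and f: "\<And>x. x \<in> S2 \<Longrightarrow> f x = (\<Sum>l\<le>n. h l x)"
    unfolding spherical_polynomials_upto_def by blast
  define h' where "h' = (\<lambda>l. if l \<le> n then h l else (\<lambda>x. 0))"
  have "(\<Sum>l\<le>m. h' l x) = (\<Sum>l\<le>n. h l x)" for x
    using assms by (intro sum.mono_neutral_cong_right) (auto simp: h'_def)
  with h f show "f \<in> spherical_polynomials_upto m"
    unfolding spherical_polynomials_upto_def
    by (intro CollectI exI[of _ h']) (auto simp: h'_def spherical_harmonics_zero)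
qed

lemma spherical_harmonics_subset_polynomials: "spherical_harmonics l \<subseteq> spherical_polynomials"
proof
  fix f assume f: "f \<in> spherical_harmonics l"
  have "(\<Sum>m\<le>l. (if m = l then f else (\<lambda>x. 0)) x) = f x" for x
    by (subst sum.remove[of _ l]) auto
  with f have "f \<in> spherical_polynomials_upto l"
    unfolding spherical_polynomials_upto_def
    by (intro CollectI exI[of _ "\<lambda>m. if m = l then f else (\<lambda>x. 0)"])
       (simp add: spherical_harmonics_zero)
  then show "f \<in> spherical_polynomials"
    by (auto simp: spherical_polynomials_def)
qed

lemma spherical_polynomials_cong:
  assumes "f \<in> spherical_polynomials" "\<And>x. x \<in> S2 \<Longrightarrow> g x = f x"
  shows "g \<in> spherical_polynomials"
  using assms unfolding spherical_polynomials_def spherical_polynomials_upto_def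
  by (simp del: mem_sphere_0)

lemma spherical_polynomials_add:
  assumes "f \<in> spherical_polynomials" "g \<in> spherical_polynomials"
  shows "(\<lambda>x. f x + g x) \<in> spherical_polynomials"
proof -
  obtain n where "f \<in> spherical_polynomials_upto n" "g \<in> spherical_polynomials_upto n"
    using assms spherical_polynomials_upto_mono unfolding spherical_polynomials_def
    by (metis UN_E max.cobounded1 max.cobounded2 subsetD)
  then obtain h k where "\<And>l. l \<le> n \<Longrightarrow> h l \<in> spherical_harmonics l"
    "\<And>x. x \<in> S2 \<Longrightarrow> f x = (\<Sum>l\<le>n. h l x)" "\<And>l. l \<le> n \<Longrightarrow> k l \<in> spherical_harmonics l"
    "\<And>x. x \<in> S2 \<Longrightarrow> g x = (\<Sum>l\<le>n. k l x)"
    unfolding spherical_polynomials_upto_def by blast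
  then have "(\<lambda>x. f x + g x) \<in> spherical_polynomials_upto n"
    unfolding spherical_polynomials_upto_def
    by (intro CollectI exI[of _ "\<lambda>l x. h l x + k l x"])
       (simp add: spherical_harmonics_add sum.distrib del: mem_sphere_0)
  then show ?thesis
    by (auto simp: spherical_polynomials_def)
qed

lemma spherical_polynomials_sum:
  "finite A \<Longrightarrow> (\<And>a. a \<in> A \<Longrightarrow> f a \<in> spherical_polynomials)
    \<Longrightarrow> (\<lambda>x. \<Sum>a\<in>A. f a x) \<in> spherical_polynomials"
  by (induction A rule: finite_induct)
     (auto intro: spherical_polynomials_add
       subsetD[OF spherical_harmonics_subset_polynomials spherical_harmonics_zero])

text \<open>On the sphere |x|^2 = 1, so the decomposition p = h + |x|^2 u becomes p = h + u with
  \<open>u\<close> of degree two less; strong induction on the degree.\<close>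

lemma homog_poly_imp_spherical_polynomial:
  "homog_poly l p \<Longrightarrow> p \<in> spherical_polynomials"
proof (induction l arbitrary: p rule: less_induct)
  case (less l)
  show ?case
  proof (cases "l < 2")
    case True
    have "p \<in> spherical_harmonics l"
      using less.prems laplacian_homog_poly_less_2[OF less.prems True]
      by (auto simp: spherical_harmonics_def homogeneous_polynomial_iff)
    then show ?thesis
      using spherical_harmonics_subset_polynomials by blast
  next
    case False
    then obtain h u where h: "homog_poly l h" "\<forall>x. laplacian h x = 0" and u: "homog_poly (l - 2) u"
      and p: "\<And>x. p x = h x + (x \<bullet> x) * u x"
      using homog_poly_harmonic_decomposition[OF less.prems] by auto
    have "h \<in> spherical_harmonics l"
      using h by (auto simp: spherical_harmonics_def homogeneous_polynomial_iff)
    moreover have "u \<in> spherical_polynomials"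
      using less.IH[OF _ u] False by simp
    ultimately have "(\<lambda>x. h x + u x) \<in> spherical_polynomials"
      using spherical_harmonics_subset_polynomials by (blast intro: spherical_polynomials_add)
    then show ?thesis
      by (rule spherical_polynomials_cong) (simp add: p norm_eq_sqrt_inner)
  qed
qed

text \<open>Products of harmonics need not be harmonic. The factors are therefore replaced by their
  homogeneous representatives, multiplied degree by degree, and each product is decomposed
  anew.\<close>

lemma spherical_polynomials_mult:
  assumes "f \<in> spherical_polynomials" "g \<in> spherical_polynomials"
  shows "(\<lambda>x. f x * g x) \<in> spherical_polynomials"
proof -
  have *: "\<exists>n p. (\<forall>l\<le>n. homog_poly l (p l)) \<and> (\<forall>x\<in>S2. f x = (\<Sum>l\<le>n. p l x))"
    if f: "f \<in> spherical_polynomials" for f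
  proof -
    obtain n h where h: "\<forall>l\<le>n. h l \<in> spherical_harmonics l" "\<forall>x\<in>S2. f x = (\<Sum>l\<le>n. h l x)"
      using f unfolding spherical_polynomials_def spherical_polynomials_upto_def by blast
    from h(1) obtain p where "\<forall>l\<le>n. homog_poly l (p l) \<and> (\<forall>x\<in>S2. h l x = p l x)"
      unfolding spherical_harmonics_def homogeneous_polynomial_iff mem_Collect_eq by metis
    with h(2) show ?thesis
      by (intro exI[of _ n] exI[of _ p]) (simp del: mem_sphere_0)
  qed
  obtain n p where p: "\<forall>l\<le>n. homog_poly l (p l)" "\<forall>x\<in>S2. f x = (\<Sum>l\<le>n. p l x)"
    using *[OF assms(1)] by blast
  obtain m q where q: "\<forall>l\<le>m. homog_poly l (q l)" "\<forall>x\<in>S2. g x = (\<Sum>l\<le>m. q l x)"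
    using *[OF assms(2)] by blast
  have "(\<lambda>x. \<Sum>l\<le>n. \<Sum>k\<le>m. p l x * q k x) \<in> spherical_polynomials"
    using p q
    by (intro spherical_polynomials_sum homog_poly_imp_spherical_polynomial[OF homog_poly_mult]) auto
  then show ?thesis
    by (rule spherical_polynomials_cong) (simp add: p q sum_product del: mem_sphere_0)
qed

lemma real_polynomial_function_imp_spherical_polynomial:
  "real_polynomial_function p \<Longrightarrow> p \<in> spherical_polynomials"
  by (induction rule: real_polynomial_function.induct)
     (auto intro: homog_poly_imp_spherical_polynomial homog_poly_linear homog_poly_const
       spherical_polynomials_add spherical_polynomials_mult)

lemma continuous_on_spherical_polynomials:
  assumes "f \<in> spherical_polynomials"
  shows "continuous_on S2 f"
proof -
  obtain n h where h: "\<And>l. l \<le> n \<Longrightarrow> h l \<in> spherical_harmonics l"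
    and f: "\<And>x. x \<in> S2 \<Longrightarrow> f x = (\<Sum>l\<le>n. h l x)"
    using assms unfolding spherical_polynomials_def spherical_polynomials_upto_def by blast
  show ?thesis
    by (rule iffD2[OF continuous_on_cong[OF refl f]])
       (assumption, intro continuous_on_sum continuous_on_spherical_harmonics[OF h], simp)
qed

text \<open>Stone-Weierstrass gives a polynomial on the ambient space, and its restriction is a sum
  of harmonics.\<close>

lemma spherical_polynomials_dense:
  assumes "continuous_on S2 f" "e > 0"
  obtains p where "p \<in> spherical_polynomials" "\<And>x. x \<in> S2 \<Longrightarrow> \<bar>f x - p x\<bar> < e"
  using Stone_Weierstrass_real_polynomial_function[of S2 f e] assms
    real_polynomial_function_imp_spherical_polynomial
  by (metis compact_sphere)

section \<open>The norm of square-integrable functions\<close>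

lemma norm_L2_nonneg: "norm_L2 f \<ge> 0"
  by (simp add: norm_L2_def)

lemma norm_L2_eq_inner: "norm_L2 f = sqrt (inner_L2 f f)"
  by (simp add: norm_L2_def inner_L2_def power2_eq_square)

text \<open>Cauchy-Schwarz: the integral of (s f - t g)^2 is a nonnegative quadratic form in
  \<open>s\<close> and \<open>t\<close>. Taking \<open>s\<close> and \<open>t\<close> as the norms
  of \<open>g\<close> and \<open>f\<close> settles the case of nonzero norms.\<close>

lemma inner_L2_le_norms:
  assumes f: "continuous_on S2 f" and g: "continuous_on S2 g"
  shows "inner_L2 f g \<le> norm_L2 f * norm_L2 g"
proof -
  have nn: "inner_L2 h h \<ge> 0" for h
    by (simp add: inner_L2_def)
  have "0 \<le> s\<^sup>2 * inner_L2 f f - 2 * s * t * inner_L2 f g + t\<^sup>2 * inner_L2 g g" for s t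
  proof -
    have "0 \<le> (\<integral>x. (s * f x - t * g x)\<^sup>2 \<partial>surface_measure)"
      by simp
    also have "(\<integral>x. (s * f x - t * g x)\<^sup>2 \<partial>surface_measure)
        = (\<integral>x. s\<^sup>2 * (f x * f x) - 2 * s * t * (f x * g x) + t\<^sup>2 * (g x * g x) \<partial>surface_measure)"
      by (intro Bochner_Integration.integral_cong) (auto simp: power2_eq_square algebra_simps)
    also have "\<dots> = s\<^sup>2 * inner_L2 f f - 2 * s * t * inner_L2 f g + t\<^sup>2 * inner_L2 g g"
      unfolding inner_L2_def
      by (simp add: integrable_surface continuous_intros f g)
    finally show ?thesis .
  qed
  note quad = this
  let ?a = "norm_L2 f" and ?b = "norm_L2 g"
  have sq: "inner_L2 f f = ?a\<^sup>2" "inner_L2 g g = ?b\<^sup>2"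
    by (simp_all add: norm_L2_eq_inner nn)
  show ?thesis
  proof (cases "?a = 0 \<or> ?b = 0")
    case False
    then have pos: "?a * ?b > 0"
      using norm_L2_nonneg[of f] norm_L2_nonneg[of g] by (auto simp: less_le)
    have "0 \<le> 2 * (?a * ?b) * (?a * ?b - inner_L2 f g)"
      using quad[of ?b ?a] by (simp add: sq power2_eq_square algebra_simps)
    with pos show ?thesis
      by (simp add: zero_le_mult_iff)
  next
    case True
    have "inner_L2 f g \<le> 0"
    proof (rule ccontr)
      assume neg: "\<not> inner_L2 f g \<le> 0"
      let ?c = "inner_L2 f g"
      from True show False
      proof
        assume "?a = 0"
        \<comment> \<open>With \<open>?a = 0\<close> the form is linear in \<open>s\<close>; this
          \<open>s\<close> makes the cross term large enough to force a negative value. The other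
          case is symmetric.\<close>
        with quad[of "(?b\<^sup>2 + 1) / ?c" 1] neg have "0 \<le> - 2 * (?b\<^sup>2 + 1) + ?b\<^sup>2"
          by (simp add: sq)
        then show False
          using zero_le_power2[of ?b] by simp
      next
        assume "?b = 0"
        with quad[of 1 "(?a\<^sup>2 + 1) / ?c"] neg have "0 \<le> - 2 * (?a\<^sup>2 + 1) + ?a\<^sup>2"
          by (simp add: sq)
        then show False
          using zero_le_power2[of ?a] by simp
      qed
    qed
    with True show ?thesis
      by auto
  qed
qed

lemma norm_L2_triangle:
  assumes f: "continuous_on S2 f" and g: "continuous_on S2 g"
  shows "norm_L2 (\<lambda>x. f x + g x) \<le> norm_L2 f + norm_L2 g"
proof -
  have "inner_L2 (\<lambda>x. f x + g x) (\<lambda>x. f x + g x)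
      = (\<integral>x. f x * f x + 2 * (f x * g x) + g x * g x \<partial>surface_measure)"
    unfolding inner_L2_def by (intro Bochner_Integration.integral_cong) (auto simp: algebra_simps)
  also have "\<dots> = inner_L2 f f + 2 * inner_L2 f g + inner_L2 g g"
    unfolding inner_L2_def by (simp add: integrable_surface continuous_intros f g)
  also have "\<dots> \<le> (norm_L2 f)\<^sup>2 + 2 * (norm_L2 f * norm_L2 g) + (norm_L2 g)\<^sup>2"
    using inner_L2_le_norms[OF f g] by (simp add: norm_L2_eq_inner) (simp add: inner_L2_def)
  also have "\<dots> = (norm_L2 f + norm_L2 g)\<^sup>2"
    by (simp add: power2_eq_square algebra_simps)
  finally show ?thesis
    by (simp add: norm_L2_eq_inner[of "\<lambda>x. f x + g x"] real_le_lsqrt norm_L2_nonneg)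
qed

lemma norm_L2_le_sup:
  assumes f: "continuous_on S2 f" and le: "\<And>x. x \<in> S2 \<Longrightarrow> \<bar>f x\<bar> \<le> e" and e: "e \<ge> 0"
  shows "norm_L2 f \<le> sqrt (4 * pi) * e"
proof -
  have "(\<integral>x. (f x)\<^sup>2 \<partial>surface_measure) \<le> (\<integral>x. e\<^sup>2 \<partial>surface_measure)"
    using le e
    by (intro integral_mono integrable_surface continuous_intros f) (auto simp: abs_le_square_iff[symmetric])
  also have "\<dots> = 4 * pi * e\<^sup>2"
    by (simp add: measure_surface_S2)
  finally have "norm_L2 f \<le> sqrt (4 * pi * e\<^sup>2)"
    by (simp add: norm_L2_def)
  then show ?thesis
    using e by (simp add: real_sqrt_mult)
qed

section \<open>Uniform boundedness\<close>

text \<open>By Baire some \<open>A M\<close> contains a ball; subadditivity moves it to the origin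
  and homogeneity scales it. Seminorms replace operators because the intended family is
  \<open>\<lambda>f. norm_L2 (L n f)\<close>, and \<open>norm_L2\<close> does not norm the functions
  on the ambient space.\<close>

lemma uniform_boundedness_seminorms:
  fixes T :: "nat \<Rightarrow> 'a::{real_normed_vector, complete_space} \<Rightarrow> real"
  assumes cont: "\<And>n. continuous_on UNIV (T n)"
    and add: "\<And>n x y. T n (x + y) \<le> T n x + T n y"
    and scale: "\<And>n c x. T n (c *\<^sub>R x) = \<bar>c\<bar> * T n x"
    and bdd: "\<And>x. \<exists>B. \<forall>n. T n x \<le> B"
  shows "\<exists>C>0. \<forall>n x. T n x \<le> C * norm x"
proof -
  define A where "A = (\<lambda>M::nat. {x. \<forall>n. T n x \<le> real M})"
  have closed: "closed (A M)" for M
    unfolding A_def by (intro closed_Collect_all closed_Collect_le cont continuous_on_const)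
  have "(\<Union>M. A M) = UNIV"
  proof (intro equalityI subsetI UN_iff[THEN iffD2])
    fix x
    obtain B where "\<forall>n. T n x \<le> B"
      using bdd by blast
    moreover obtain M where "B \<le> real M"
      using real_arch_simple by blast
    ultimately show "\<exists>M\<in>UNIV. x \<in> A M"
      unfolding A_def by (blast intro: order_trans)
  qed simp
  moreover have "interior (\<Union>M. A M) = {}" if "\<And>M. interior (A M) = {}"
    using Met_TC.metric_Baire_category_alt[of "range A"] closed that complete_UNIV
    by fastforce
  ultimately obtain M where "interior (A M) \<noteq> {}"
    by auto
  then obtain x0 e where e: "e > 0" "ball x0 e \<subseteq> A M"
    using mem_interior by blast
  have M: "T n y \<le> real M" if "dist x0 y < e" for n y
    using that e(2) by (auto simp: A_def)
  \<comment> \<open>Subadditivity on \<open>x\<close> and \<open>- x\<close>, whose sum 0 has value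
    0, together with \<open>T n (- x) = T n x\<close>.\<close>
  have nonneg: "T n x \<ge> 0" for n x
    using add[of n x "- 1 *\<^sub>R x"] scale[of n "- 1" x] scale[of n 0 x] by simp
  have small: "T n z \<le> 2 * real M" if "norm z < e" for n z
  proof -
    have "T n z \<le> T n (x0 + z) + T n (- 1 *\<^sub>R x0)"
      using add[of n "x0 + z" "- 1 *\<^sub>R x0"] by simp
    also have "T n (- 1 *\<^sub>R x0) = T n x0"
      by (simp only: scale)
    finally show ?thesis
      using M[of "x0 + z" n] M[of x0 n] that e(1) by (simp add: dist_norm)
  qed
  \<comment> \<open>The summand 1 keeps the constant positive even if \<open>M = 0\<close>.\<close>
  have "T n x \<le> (4 * real M / e + 1) * norm x" for n x
  proof (cases "x = 0")
    case True
    then show ?thesis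
      using scale[of n 0 0] by simp
  next
    case False
    \<comment> \<open>Scales \<open>x\<close> to norm \<open>e / 2\<close>, inside the ball where
      \<open>small\<close> applies.\<close>
    define c where "c = e / (2 * norm x)"
    have c: "c > 0"
      using False e by (simp add: c_def)
    have "c * T n x = T n (c *\<^sub>R x)"
      using c by (simp add: scale)
    also have "\<dots> \<le> 2 * real M"
      using False e by (intro small) (simp add: c_def)
    finally have "T n x \<le> 2 * real M / c"
      using c by (simp add: pos_le_divide_eq mult.commute)
    also have "\<dots> = 4 * real M / e * norm x"
      using False e by (simp add: c_def)
    also have "\<dots> \<le> (4 * real M / e + 1) * norm x"
      by (intro mult_right_mono) auto
    finally show ?thesis .
  qed
  moreover have "4 * real M / e + 1 > 0"
    using e by (simp add: add_nonneg_pos)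
  ultimately show ?thesis
    by blast
qed

text \<open>Quadrature sums are finite combinations of point evaluations, so this makes them
  continuous on the Banach space of bounded continuous functions.\<close>

lemma bounded_linear_apply_bcontfun:
  fixes x :: "'a::topological_space"
  shows "bounded_linear (\<lambda>f :: 'a \<Rightarrow>\<^sub>C 'b::real_normed_vector. apply_bcontfun f x)"
  by (rule bounded_linear_intro[where K = 1]) (simp_all add: norm_bounded)

section \<open>Hyperinterpolation\<close>

context
  fixes N :: nat and x :: "nat \<Rightarrow> real^3" and w :: "nat \<Rightarrow> real"
begin

lemma quadrature_add:
  "quadrature N x w (\<lambda>y. f y + g y) = quadrature N x w f + quadrature N x w g"
  by (simp add: quadrature_def sum.distrib algebra_simps)

lemma quadrature_cmult: "quadrature N x w (\<lambda>y. c * f y) = c * quadrature N x w f"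
  by (simp add: quadrature_def sum_distrib_left algebra_simps)

lemma quadrature_diff:
  "quadrature N x w (\<lambda>y. f y - g y) = quadrature N x w f - quadrature N x w g"
  by (simp add: quadrature_def sum_subtractf algebra_simps)

lemma hyperinterpolation_diff:
  "hyperinterpolation Y n (quadrature N x w) (\<lambda>y. f y - g y) z =
     hyperinterpolation Y n (quadrature N x w) f z - hyperinterpolation Y n (quadrature N x w) g z"
  by (simp add: hyperinterpolation_def left_diff_distrib quadrature_diff sum_subtractf)

end

text \<open>Flattens the double sum over degree and order into one finite index set, so that
  coefficient families can be measured by \<open>L2_set\<close>.\<close>

definition harmonic_index :: "nat \<Rightarrow> (nat \<times> int) set" where
  "harmonic_index n = Sigma {..n} (\<lambda>l. {- int l..int l})"

lemma finite_harmonic_index [simp]: "finite (harmonic_index n)"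
  by (simp add: harmonic_index_def)

lemma sum_harmonic_index:
  "(\<Sum>i\<in>harmonic_index n. case i of (l, k) \<Rightarrow> f l k) = (\<Sum>l\<le>n. \<Sum>k = - int l..int l. f l k)"
  unfolding harmonic_index_def by (subst sum.Sigma) auto

context
  fixes Y :: "nat \<Rightarrow> int \<Rightarrow> real^3 \<Rightarrow> real"
  assumes basis: "\<And>l. orthonormal_harmonic_basis l (Y l)"
begin

abbreviation Yi :: "nat \<times> int \<Rightarrow> real^3 \<Rightarrow> real" where
  "Yi i \<equiv> Y (fst i) (snd i)"

lemma hyperinterpolation_eq:
  "hyperinterpolation Y n Q f y = (\<Sum>i\<in>harmonic_index n. Q (\<lambda>z. f z * Yi i z) * Yi i y)"
  unfolding hyperinterpolation_def sum_harmonic_index[symmetric] by (simp add: case_prod_beta)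

lemma basis_mem: "i \<in> harmonic_index n \<Longrightarrow> Yi i \<in> spherical_harmonics (fst i)"
  using basis[of "fst i"] by (auto simp: orthonormal_harmonic_basis_def harmonic_index_def)

lemma continuous_on_basis: "i \<in> harmonic_index n \<Longrightarrow> continuous_on S2 (Yi i)"
  by (rule continuous_on_spherical_harmonics[OF basis_mem])

text \<open>Equal degrees are covered by the assumption on the basis, different degrees by
  \<open>spherical_harmonics_orthogonal\<close>.\<close>

lemma inner_L2_basis:
  assumes "i \<in> harmonic_index n" "j \<in> harmonic_index n"
  shows "inner_L2 (Yi i) (Yi j) = (if i = j then 1 else 0)"
proof (cases "fst i = fst j")
  case True
  have mem: "snd i \<in> {- int (fst i)..int (fst i)}" "snd j \<in> {- int (fst i)..int (fst i)}"
    using assms True by (auto simp: harmonic_index_def)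
  have "\<forall>k\<in>{- int (fst i)..int (fst i)}. \<forall>k'\<in>{- int (fst i)..int (fst i)}.
      inner_L2 (Y (fst i) k) (Y (fst i) k') = (if k = k' then 1 else 0)"
    using basis[of "fst i"] unfolding orthonormal_harmonic_basis_def by blast
  from bspec[OF bspec[OF this mem(1)] mem(2)] True show ?thesis
    by (simp add: prod_eq_iff)
next
  case False
  with spherical_harmonics_orthogonal[OF basis_mem[OF assms(1)] basis_mem[OF assms(2)] False]
  show ?thesis
    by auto
qed

text \<open>Parseval's identity: orthonormality leaves only the diagonal of the double sum.\<close>

lemma norm_L2_expansion:
  "norm_L2 (\<lambda>y. \<Sum>i\<in>harmonic_index n. c i * Yi i y) = L2_set c (harmonic_index n)"
proof -
  let ?I = "harmonic_index n"
  have "(\<integral>y. (\<Sum>i\<in>?I. c i * Yi i y)\<^sup>2 \<partial>surface_measure)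
      = (\<integral>y. (\<Sum>i\<in>?I. \<Sum>j\<in>?I. c i * c j * (Yi i y * Yi j y)) \<partial>surface_measure)"
    by (simp add: power2_eq_square sum_product mult_ac)
  also have "\<dots> = (\<Sum>i\<in>?I. \<Sum>j\<in>?I. c i * c j * inner_L2 (Yi i) (Yi j))"
    unfolding inner_L2_def
    by (subst Bochner_Integration.integral_sum,
        fastforce intro!: integrable_surface continuous_intros continuous_on_basis)
       (intro sum.cong refl, subst Bochner_Integration.integral_sum,
         auto intro!: integrable_surface continuous_intros continuous_on_basis)
  also have "\<dots> = (\<Sum>i\<in>?I. \<Sum>j\<in>?I. if i = j then c i * c j else 0)"
    by (intro sum.cong refl) (auto simp: inner_L2_basis)
  also have "\<dots> = (\<Sum>i\<in>?I. (c i)\<^sup>2)"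
    by (simp add: power2_eq_square)
  finally show ?thesis
    by (simp add: norm_L2_def L2_set_def)
qed

lemma norm_L2_hyperinterpolation:
  "norm_L2 (hyperinterpolation Y n Q f) = L2_set (\<lambda>i. Q (\<lambda>z. f z * Yi i z)) (harmonic_index n)"
  using norm_L2_expansion[where n = n and c = "\<lambda>i. Q (\<lambda>z. f z * Yi i z)"]
  by (simp add: hyperinterpolation_eq[abs_def])

lemma spherical_polynomials_upto_expansion:
  assumes "p \<in> spherical_polynomials_upto n"
  obtains c where "\<And>y. y \<in> S2 \<Longrightarrow> p y = (\<Sum>i\<in>harmonic_index n. c i * Yi i y)"
proof -
  obtain h where h: "\<forall>l\<le>n. h l \<in> spherical_harmonics l" "\<forall>y\<in>S2. p y = (\<Sum>l\<le>n. h l y)"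
    using assms by (auto simp: spherical_polynomials_upto_def)
  have "\<forall>l\<le>n. \<exists>c. \<forall>y\<in>S2. h l y = (\<Sum>k = - int l..int l. c k * Y l k y)"
    using h(1) basis by (auto simp: orthonormal_harmonic_basis_def)
  then obtain c where c: "\<forall>l\<le>n. \<forall>y\<in>S2. h l y = (\<Sum>k = - int l..int l. c l k * Y l k y)"
    by metis
  have "p y = (\<Sum>i\<in>harmonic_index n. c (fst i) (snd i) * Yi i y)" if "y \<in> S2" for y
    using that h(2) c sum_harmonic_index[of "\<lambda>l k. c l k * Y l k y" n]
    by (simp add: case_prod_beta del: mem_sphere_0)
  then show ?thesis
    by (rule that)
qed

lemma hyperinterpolation_mem: "hyperinterpolation Y n Q f \<in> spherical_polynomials_upto n"
  unfolding spherical_polynomials_upto_def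
proof (intro CollectI exI conjI allI impI ballI)
  show "(\<lambda>y. \<Sum>k = - int l..int l. Q (\<lambda>z. f z * Y l k z) * Y l k y) \<in> spherical_harmonics l" for l
    using basis[of l]
    by (intro spherical_harmonics_sum spherical_harmonics_cmult)
       (auto simp: orthonormal_harmonic_basis_def)
qed (simp add: hyperinterpolation_def)

lemma continuous_on_hyperinterpolation: "continuous_on S2 (hyperinterpolation Y n Q f)"
  using hyperinterpolation_mem
  by (intro continuous_on_spherical_polynomials) (auto simp: spherical_polynomials_def)

section \<open>Quadrature bounds and bounds on hyperinterpolation\<close>

context
  fixes N :: nat and x :: "nat \<Rightarrow> real^3" and w :: "nat \<Rightarrow> real"
  assumes data: "quadrature_data N x"
begin

text \<open>The nodes lie on the sphere, so an expansion of \<open>p\<close> valid only there can be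
  inserted into the quadrature sum.\<close>

lemma quadrature_mult_expansion:
  assumes "\<And>y. y \<in> S2 \<Longrightarrow> p y = (\<Sum>i\<in>I. c i * g i y)"
  shows "quadrature N x w (\<lambda>y. f y * p y) = (\<Sum>i\<in>I. c i * quadrature N x w (\<lambda>y. f y * g i y))"
proof -
  have "quadrature N x w (\<lambda>y. f y * p y)
      = (\<Sum>j = 1..N. \<Sum>i\<in>I. c i * (w j * (f (x j) * g i (x j))))"
    using data assms
    by (simp add: quadrature_def quadrature_data_def sum_distrib_left mult_ac del: mem_sphere_0)
  also have "\<dots> = (\<Sum>i\<in>I. c i * quadrature N x w (\<lambda>y. f y * g i y))"
    by (subst sum.swap) (simp add: quadrature_def sum_distrib_left)
  finally show ?thesis .
qed

text \<open>Pairing \<open>p\<close> with the hyperinterpolant of a function that has the sign of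
  \<open>w j * p (x j)\<close> at each node turns the weighted sum into an \<open>L\<^sup>2\<close> inner product.\<close>
lemma quadrature_abs_le:
  assumes p: "p \<in> spherical_polynomials_upto n"
    and bound: "\<And>f. continuous_on UNIV f \<Longrightarrow> (\<And>y. \<bar>f y\<bar> \<le> 1)
      \<Longrightarrow> norm_L2 (hyperinterpolation Y n (quadrature N x w) f) \<le> C"
  shows "(\<Sum>j = 1..N. \<bar>w j\<bar> * \<bar>p (x j)\<bar>) \<le> C * norm_L2 p"
proof -
  obtain c where c: "\<And>y. y \<in> S2 \<Longrightarrow> p y = (\<Sum>i\<in>harmonic_index n. c i * Yi i y)"
    using spherical_polynomials_upto_expansion[OF p] by blast
  \<comment> \<open>As the nodes are distinct, \<open>inv_into\<close> recovers the index of a node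
    and hence its weight. Tietze's theorem then extends the signs from the finite node set to a
    continuous function with values in [-1, 1].\<close>
  define s where "s = (\<lambda>y. sgn (w (inv_into {1..N} x y) * p y))"
  obtain f where f: "continuous_on UNIV f" "\<And>y. y \<in> x ` {1..N} \<Longrightarrow> f y = s y"
    "\<And>y. f y \<in> cbox (- 1) 1"
  proof (rule Tietze_closed_interval_1[of "x ` {1..N}" s UNIV "- 1" 1])
    show "continuous_on (x ` {1..N}) s"
      by (intro continuous_on_finite) simp
    show "closedin (top_of_set UNIV) (x ` {1..N})"
      by (simp add: finite_imp_closed)
  qed (auto simp: s_def sgn_if)
  let ?a = "\<lambda>i. quadrature N x w (\<lambda>y. f y * Yi i y)"
  have "\<bar>w j\<bar> * \<bar>p (x j)\<bar> = w j * (f (x j) * p (x j))" if "j \<in> {1..N}" for j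
  proof -
    have "inv_into {1..N} x (x j) = j"
      using data that by (simp add: quadrature_data_def inv_into_f_f)
    then have "f (x j) = sgn (w j * p (x j))"
      using f(2)[of "x j"] that by (simp add: s_def)
    then show ?thesis
      by (simp add: sgn_if abs_if zero_less_mult_iff)
  qed
  then have "(\<Sum>j = 1..N. \<bar>w j\<bar> * \<bar>p (x j)\<bar>) = quadrature N x w (\<lambda>y. f y * p y)"
    by (simp add: quadrature_def)
  also have "\<dots> = (\<Sum>i\<in>harmonic_index n. c i * ?a i)"
    by (rule quadrature_mult_expansion[OF c])
  also have "\<dots> \<le> (\<Sum>i\<in>harmonic_index n. \<bar>c i\<bar> * \<bar>?a i\<bar>)"
    by (intro sum_mono) (simp flip: abs_mult)
  \<comment> \<open>Cauchy-Schwarz for the coefficients; by Parseval the factors are the norms of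
    \<open>p\<close> and of the hyperinterpolant of \<open>f\<close>.\<close>
  also have "\<dots> \<le> L2_set c (harmonic_index n) * L2_set ?a (harmonic_index n)"
    by (rule L2_set_mult_ineq)
  also have "L2_set c (harmonic_index n) = norm_L2 p"
    using norm_L2_expansion[where n = n and c = c] norm_L2_cong[OF c] by simp
  also have "L2_set ?a (harmonic_index n) = norm_L2 (hyperinterpolation Y n (quadrature N x w) f)"
    by (simp add: norm_L2_hyperinterpolation)
  also have "norm_L2 p * \<dots> \<le> norm_L2 p * C"
    using f(1,3) by (intro mult_left_mono bound norm_L2_nonneg) (auto simp: abs_le_iff minus_le_iff)
  finally show ?thesis
    by (simp add: mult.commute)
qed

text \<open>The assumed bound is applied to the hyperinterpolant itself, whose squared norm is a
  quadrature value; one factor of the norm then cancels.\<close>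

lemma norm_L2_hyperinterpolation_le:
  assumes C: "\<And>p. p \<in> spherical_polynomials_upto n
      \<Longrightarrow> (\<Sum>j = 1..N. \<bar>w j\<bar> * \<bar>p (x j)\<bar>) \<le> C * norm_L2 p"
    and f: "\<And>y. y \<in> S2 \<Longrightarrow> \<bar>f y\<bar> \<le> e" and nonneg: "C \<ge> 0" "e \<ge> 0"
  shows "norm_L2 (hyperinterpolation Y n (quadrature N x w) f) \<le> C * e"
proof -
  let ?Lf = "hyperinterpolation Y n (quadrature N x w) f"
  let ?a = "\<lambda>i. quadrature N x w (\<lambda>y. f y * Yi i y)"
  have "(norm_L2 ?Lf)\<^sup>2 = (\<Sum>i\<in>harmonic_index n. ?a i * ?a i)"
    by (simp add: norm_L2_hyperinterpolation L2_set_def sum_nonneg power2_eq_square)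
  also have "\<dots> = quadrature N x w (\<lambda>y. f y * ?Lf y)"
    by (rule quadrature_mult_expansion[symmetric]) (rule hyperinterpolation_eq)
  also have "\<dots> \<le> (\<Sum>j = 1..N. e * (\<bar>w j\<bar> * \<bar>?Lf (x j)\<bar>))"
    unfolding quadrature_def[of N x w "\<lambda>y. f y * ?Lf y"]
  proof (rule sum_mono)
    fix j assume "j \<in> {1..N}"
    then have "\<bar>f (x j)\<bar> \<le> e"
      using data f by (auto simp: quadrature_data_def)
    then have "\<bar>f (x j)\<bar> * (\<bar>w j\<bar> * \<bar>?Lf (x j)\<bar>) \<le> e * (\<bar>w j\<bar> * \<bar>?Lf (x j)\<bar>)"
      by (intro mult_right_mono) auto
    moreover have "w j * (f (x j) * ?Lf (x j)) \<le> \<bar>f (x j)\<bar> * (\<bar>w j\<bar> * \<bar>?Lf (x j)\<bar>)"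
      using abs_ge_self[of "w j * (f (x j) * ?Lf (x j))"] by (simp add: abs_mult mult_ac)
    ultimately show "w j * (f (x j) * ?Lf (x j)) \<le> e * (\<bar>w j\<bar> * \<bar>?Lf (x j)\<bar>)"
      by linarith
  qed
  also have "\<dots> \<le> e * (C * norm_L2 ?Lf)"
    unfolding sum_distrib_left[symmetric]
    by (intro mult_left_mono C hyperinterpolation_mem nonneg)
  finally have "norm_L2 ?Lf * norm_L2 ?Lf \<le> C * e * norm_L2 ?Lf"
    by (simp add: power2_eq_square mult_ac)
  then show ?thesis
    using norm_L2_nonneg[of ?Lf] nonneg
    by (cases "norm_L2 ?Lf = 0") (auto simp: less_le)
qed

end

text \<open>By Parseval \<open>\<lambda>f. norm_L2 (L n f)\<close> is an \<open>L2_set\<close> of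
  finitely many quadrature values, hence a continuous seminorm on the bounded continuous functions
  of the ambient space. Convergence bounds it for each \<open>f\<close>, so uniform boundedness
  applies.\<close>

lemma hyperinterpolation_uniformly_bounded:
  fixes N :: "nat \<Rightarrow> nat" and x :: "nat \<Rightarrow> nat \<Rightarrow> real^3" and w :: "nat \<Rightarrow> nat \<Rightarrow> real"
  defines "L \<equiv> \<lambda>n. hyperinterpolation Y n (quadrature (N n) (x n) (w n))"
  assumes conv: "\<And>f. continuous_on S2 f \<Longrightarrow> (\<lambda>n. norm_L2 (\<lambda>y. L n f y - f y)) \<longlonglongrightarrow> 0"
  shows "\<exists>C>0. \<forall>n f. continuous_on UNIV f \<longrightarrow> (\<forall>y. \<bar>f y\<bar> \<le> 1) \<longrightarrow> norm_L2 (L n f) \<le> C"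
proof -
  define a where "a = (\<lambda>n (f :: (real^3) \<Rightarrow>\<^sub>C real) i.
    quadrature (N n) (x n) (w n) (\<lambda>z. apply_bcontfun f z * Yi i z))"
  define T where "T = (\<lambda>n f. L2_set (a n f) (harmonic_index n))"
  have T_eq: "T n f = norm_L2 (L n (apply_bcontfun f))" for n f
    by (simp add: T_def a_def L_def norm_L2_hyperinterpolation)
  have a_add: "a n (f + g) = (\<lambda>i. a n f i + a n g i)" for n f g
    by (simp add: a_def distrib_right quadrature_add)
  have a_scale: "a n (c *\<^sub>R f) = (\<lambda>i. c * a n f i)" for n c f
    by (simp add: a_def mult.assoc quadrature_cmult)
  have "\<exists>C>0. \<forall>n f. T n f \<le> C * norm f"
  proof (rule uniform_boundedness_seminorms[of T])
    show "continuous_on UNIV (T n)" for n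
      unfolding T_def L2_set_def a_def quadrature_def
      by (intro continuous_intros bounded_linear.continuous_on[OF bounded_linear_apply_bcontfun])
    show "T n (f + g) \<le> T n f + T n g" for n f g
      unfolding T_def a_add by (rule L2_set_triangle_ineq)
    show "T n (c *\<^sub>R f) = \<bar>c\<bar> * T n f" for n c f
      by (simp add: T_def a_scale L2_set_right_distrib) (simp add: L2_set_def power_mult_distrib)
    show "\<exists>B. \<forall>n. T n f \<le> B" for f
    proof -
      have f: "continuous_on S2 (apply_bcontfun f)"
        by simp
      have "Bseq (\<lambda>n. norm_L2 (\<lambda>y. L n f y - f y))"
        using conv[OF f] by (intro convergent_imp_Bseq convergentI)
      then obtain B where B: "\<And>n. norm_L2 (\<lambda>y. L n f y - f y) \<le> B"
        by (auto simp: Bseq_def norm_L2_nonneg)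
      have "T n f \<le> B + norm_L2 f" for n
      proof -
        have "continuous_on S2 (\<lambda>y. L n f y - f y)"
          unfolding L_def by (intro continuous_intros continuous_on_hyperinterpolation f)
        from norm_L2_triangle[OF this f] B[of n] show ?thesis
          by (simp add: T_eq)
      qed
      then show ?thesis
        by blast
    qed
  qed
  then obtain C where C: "C > 0" "\<And>n f. T n f \<le> C * norm f"
    by blast
  have "norm_L2 (L n f) \<le> C" if "continuous_on UNIV f" "\<forall>y. \<bar>f y\<bar> \<le> 1" for n f
  proof -
    define F where "F = Bcontfun f"
    have F: "apply_bcontfun F = f"
      unfolding F_def using that by (intro Bcontfun_inverse bcontfun_normI[of f 1]) auto
    have "norm F \<le> 1"
      using that by (intro norm_bound) (simp add: F)
    with C have "C * norm F \<le> C"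
      by simp
    with C(2)[of n F] show ?thesis
      by (simp add: T_eq F)
  qed
  with C(1) show ?thesis
    by blast
qed

end

section \<open>Convergence is equivalent to stability and convergence on polynomials\<close>

theorem theorem5p5:
  fixes Y :: "nat \<Rightarrow> int \<Rightarrow> real^3 \<Rightarrow> real"
    and N :: "nat \<Rightarrow> nat"
    and x :: "nat \<Rightarrow> nat \<Rightarrow> real^3"
    and w :: "nat \<Rightarrow> nat \<Rightarrow> real"
  defines "L \<equiv> \<lambda>n. hyperinterpolation Y n (quadrature (N n) (x n) (w n))"
  assumes "\<And>l. orthonormal_harmonic_basis l (Y l)"
    and "\<And>n. n \<ge> 1 \<Longrightarrow> quadrature_data (N n) (x n)"
  shows "(\<forall>f. continuous_on S2 f \<longrightarrow> (\<lambda>n. norm_L2 (\<lambda>y. L n f y - f y)) \<longlonglongrightarrow> 0)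
     \<longleftrightarrow>
     (\<exists>C>0. \<forall>n\<ge>1. \<forall>p\<in>spherical_polynomials_upto n.
        (\<Sum>j = 1..N n. \<bar>w n j\<bar> * \<bar>p (x n j)\<bar>) \<le> C * norm_L2 p) \<and>
     (\<forall>p\<in>spherical_polynomials. (\<lambda>n. norm_L2 (\<lambda>y. L n p y - p y)) \<longlonglongrightarrow> 0)"
  (is "?conv \<longleftrightarrow> ?stable \<and> ?conv_poly")
proof (intro iffI conjI)
  assume ?conv
  then show ?conv_poly
    by (auto intro: continuous_on_spherical_polynomials)
  have "\<exists>C>0. \<forall>n f. continuous_on UNIV f \<longrightarrow> (\<forall>y. \<bar>f y\<bar> \<le> 1) \<longrightarrow> norm_L2 (L n f) \<le> C"
    unfolding L_def
    by (rule hyperinterpolation_uniformly_bounded[OF assms(2)])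
       (use \<open>?conv\<close> in \<open>simp add: L_def\<close>)
  then obtain C where C: "C > 0"
    "\<And>n f. continuous_on UNIV f \<Longrightarrow> (\<And>y. \<bar>f y\<bar> \<le> 1) \<Longrightarrow> norm_L2 (L n f) \<le> C"
    by blast
  show ?stable
  proof (intro exI[of _ C] conjI allI impI ballI)
    fix n p assume "n \<ge> 1" "p \<in> spherical_polynomials_upto n"
    then show "(\<Sum>j = 1..N n. \<bar>w n j\<bar> * \<bar>p (x n j)\<bar>) \<le> C * norm_L2 p"
      using C(2) assms(2,3) unfolding L_def by (intro quadrature_abs_le) auto
  qed (rule C)
next
  assume "?stable \<and> ?conv_poly"
  then obtain C where C: "C > 0" "\<And>n p. n \<ge> 1 \<Longrightarrow> p \<in> spherical_polynomials_upto n
      \<Longrightarrow> (\<Sum>j = 1..N n. \<bar>w n j\<bar> * \<bar>p (x n j)\<bar>) \<le> C * norm_L2 p"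
    and conv_poly: ?conv_poly
    by blast
  show ?conv
  proof (intro allI impI LIMSEQ_I)
    fix f :: "real^3 \<Rightarrow> real" and r :: real
    assume f: "continuous_on S2 f" and r: "r > 0"
    \<comment> \<open>Replacing \<open>f\<close> by \<open>p\<close> costs \<open>C * e\<close>
      through the hyperinterpolant and \<open>sqrt (4 * pi) * e\<close> directly,
      \<open>4 * pi\<close> being the area of the sphere. The choice of \<open>e\<close> makes the
      total \<open>r / 2\<close>.\<close>
    define K where "K = C + sqrt (4 * pi)"
    define e where "e = r / (2 * K)"
    have K: "K > 0"
      using C(1) by (simp add: K_def add_pos_nonneg)
    then have e: "e > 0"
      using r by (simp add: e_def)
    obtain p where p: "p \<in> spherical_polynomials" "\<And>y. y \<in> S2 \<Longrightarrow> \<bar>f y - p y\<bar> < e"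
      using spherical_polynomials_dense[OF f e] by blast
    have p_cont: "continuous_on S2 p"
      using p(1) by (rule continuous_on_spherical_polynomials)
    have "(\<lambda>n. norm_L2 (\<lambda>y. L n p y - p y)) \<longlonglongrightarrow> 0"
      using conv_poly p(1) by blast
    from LIMSEQ_D[OF this, of "r / 2"] r
    obtain n0 where n0: "\<And>n. n \<ge> n0 \<Longrightarrow> norm_L2 (\<lambda>y. L n p y - p y) < r / 2"
      by (auto simp: norm_L2_nonneg)
    \<comment> \<open>The maximum with 1 is taken because the stability bound is available only from
      index 1 on.\<close>
    have "norm_L2 (\<lambda>y. L n f y - f y) < r" if n: "n \<ge> max 1 n0" for n
    proof -
      have L_cont: "continuous_on S2 (L n g)" for g
        unfolding L_def using assms(2) by (rule continuous_on_hyperinterpolation)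
      have "norm_L2 (\<lambda>y. L n f y - f y)
          = norm_L2 (\<lambda>y. L n (\<lambda>y. f y - p y) y + ((L n p y - p y) + (p y - f y)))"
        by (intro norm_L2_cong) (simp add: L_def hyperinterpolation_diff)
      also have "\<dots> \<le> norm_L2 (L n (\<lambda>y. f y - p y)) + norm_L2 (\<lambda>y. (L n p y - p y) + (p y - f y))"
        by (intro norm_L2_triangle L_cont continuous_intros p_cont f)
      also have "norm_L2 (\<lambda>y. (L n p y - p y) + (p y - f y))
          \<le> norm_L2 (\<lambda>y. L n p y - p y) + norm_L2 (\<lambda>y. p y - f y)"
        by (intro norm_L2_triangle L_cont continuous_intros p_cont f)
      also have "norm_L2 (L n (\<lambda>y. f y - p y)) \<le> C * e"
        unfolding L_def
        using n C e less_imp_le[OF p(2)] assms(2,3)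
        by (intro norm_L2_hyperinterpolation_le) (auto simp del: mem_sphere_0)
      also have "norm_L2 (\<lambda>y. p y - f y) \<le> sqrt (4 * pi) * e"
        using less_imp_le[OF p(2)] e
        by (intro norm_L2_le_sup continuous_intros p_cont f) (auto simp: abs_minus_commute simp del: mem_sphere_0)
      also have "norm_L2 (\<lambda>y. L n p y - p y) < r / 2"
        using n n0 by simp
      also have "C * e + (r / 2 + sqrt (4 * pi) * e) = K * e + r / 2"
        by (simp add: K_def algebra_simps)
      also have "\<dots> = r"
        using K by (simp add: e_def)
      finally show ?thesis
        by simp
    qed
    then show "\<exists>no. \<forall>n\<ge>no. norm (norm_L2 (\<lambda>y. L n f y - f y) - 0) < r"
      by (intro exI[of _ "max 1 n0"]) (simp add: norm_L2_nonneg)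
  qed
qed

end
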